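(* Consider the noise-intervened Hegselmann–Krause system with an additional leader agent described in the context, with $n$ ordinary agents $\mathcal V=\{1,\dots,n\}$, confidence threshold $\epsilon>0$, divisive initial state with cluster values $x_1^*<\dots<x_{N_c}^*$, leader opinion $A>x_{N_c}^*+\epsilon$, and noise uniformly distributed on $[-\delta_1,\delta_2]$ with $0\le\delta_1\le\delta_2$ and $0<\delta_2\le\frac{\epsilon}{2n}$. Let $d_{\mathcal V}^A(t)=\max_{i\in\mathcal V}|x_i(t)-A|$ and $T_l=\inf\{t\ge0: d_{\mathcal V}^A(t)\le\epsilon\}$. Then: 1. if $\delta_1=\delta_2$, then $\mathbf E\,T_l=\infty$; 2. if $\delta_1<\delta_2$, then $\mathbf E\,T_l\le\frac{2n}{\delta_2-\delta_1}\bigl(A-x_1^*+\epsilon+N_c\delta_2\bigr)$.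
   Context: Time $t\in\{0,1,2,\dots\}$ is discrete. Ordinary agents are $\mathcal V=\{1,\dots,n\}$, with opinions $x_i(t)\in\mathbb R$. There is one additional leader agent $l\notin\mathcal V$ whose opinion is constant: $x_l(t)=A$ for all $t\ge0$. The confidence threshold is $\epsilon>0$. The neighbor set of an ordinary agent $i\in\mathcal V$ is $\mathcal N_i(x(t))=\{j\in\mathcal V\cup\{l\}: |x_j(t)-x_i(t)|\le\epsilon\}$ (so the leader counts as a neighbor whenever its opinion is within $\epsilon$). Divisive initial state: $\mathcal V$ is partitioned into nonempty disjoint clusters $\mathcal V_1,\dots,\mathcal V_{N_c}$ with $2\le N_c\le n$; there are real numbers $x_1^*,\dots,x_{N_c}^*$ with $x_p^*-x_q^*>\epsilon$ for all $1\le q<p\le N_c$; and $x_i(0)=x_g^*$ for every $i\in\mathcal V_g$, $1\le g\le N_c$. Agent $1$ belongs to $\mathcal V_1$ (the cluster with the smallest opinion value). The leader's opinion satisfies $A>x_{N_c}^*+\epsilon$. Dynamics: for all $i\in\mathcal V$ and $t\ge0$, $$x_i(t+1)=\frac{1}{|\mathcal N_i(x(t))|}\sum_{j\in\mathcal N_i(x(t))}x_j(t)+I_{\{i=1\}}\,\xi(t+1),$$ where $I_{\{i=1\}}$ equals $1$ if $i=1$ and $0$ otherwise, and $\{\xi(t),t\ge1\}$ are independent random variables, each uniformly distributed on $[-\delta_1,\delta_2]$, with $0\le\delta_1\le\delta_2$. $\mathbf E$ denotes expectation. *)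

theory Defs
  imports "HOL-Probability.Probability"
begin

datatype agent = Leader | Ordinary nat

definition agents :: "nat \<Rightarrow> agent set" where
  "agents n = Ordinary ` {1..n} \<union> {Leader}"

definition neighbors :: "nat \<Rightarrow> real \<Rightarrow> (agent \<Rightarrow> real) \<Rightarrow> nat \<Rightarrow> agent set" where
  "neighbors n \<epsilon> x i = {j \<in> agents n. \<bar>x j - x (Ordinary i)\<bar> \<le> \<epsilon>}"

definition leader_dist :: "nat \<Rightarrow> real \<Rightarrow> (agent \<Rightarrow> real) \<Rightarrow> real" where
  "leader_dist n A x = (MAX i\<in>{1..n}. \<bar>x (Ordinary i) - A\<bar>)"

text \<open>The infimum is taken in the extended nonnegative reals, so it is \<open>\<infinity>\<close> along a
  trajectory that never comes within \<open>\<epsilon>\<close> of the leader.\<close>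

definition leader_time :: "nat \<Rightarrow> real \<Rightarrow> real \<Rightarrow> (nat \<Rightarrow> agent \<Rightarrow> real) \<Rightarrow> ennreal" where
  "leader_time n \<epsilon> A x = (INF t\<in>{t. leader_dist n A (x t) \<le> \<epsilon>}. of_nat t)"

text \<open>The clusters are \<open>V 1, \<dots>, V Nc\<close>, with initial opinions \<open>xs 1 < \<dots> < xs Nc\<close>.\<close>

definition divisive_initial ::
  "nat \<Rightarrow> real \<Rightarrow> nat \<Rightarrow> (nat \<Rightarrow> nat set) \<Rightarrow> (nat \<Rightarrow> real) \<Rightarrow> (agent \<Rightarrow> real) \<Rightarrow> bool" where
  "divisive_initial n \<epsilon> Nc V xs x0 \<longleftrightarrow>
     2 \<le> Nc \<and> Nc \<le> n \<and>
     (\<Union>g\<in>{1..Nc}. V g) = {1..n} \<and>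
     (\<forall>g\<in>{1..Nc}. V g \<noteq> {}) \<and>
     disjoint_family_on V {1..Nc} \<and>
     (\<forall>p q. 1 \<le> q \<and> q < p \<and> p \<le> Nc \<longrightarrow> xs p - xs q > \<epsilon>) \<and>
     (\<forall>g\<in>{1..Nc}. \<forall>i\<in>V g. x0 (Ordinary i) = xs g)"

end

theory Submission
  imports Defs
begin

text \<open>
Agent 1 carries the noise, and the other members of its group follow the mean of the group.
While the group is isolated, that mean is a random walk with step \<open>\<xi> / m\<close>, where \<open>m\<close>
is the size of the group. When agent 1 comes within \<open>\<epsilon>\<close> of the next cluster, the smallness
of the noise makes the two merge within one step, and the merger only pulls the mean to the
right; the leader pulls it to the right as well. Hence up to \<open>T\<^sub>l\<close> the mean grows by at least
\<open>\<xi> / m\<close> in each step, \<open>m \<le> n\<close>, and it never exceeds \<open>A\<close>. If the noise has positive mean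
\<open>(\<delta>2 - \<delta>1) / 2\<close>, Wald's identity for the truncated time bounds \<open>E T\<^sub>l\<close>. If the mean is
zero, the first group descends far with positive probability, and a centred walk needs an infinite
expected time to climb back.
\<close>

subsection \<open>The deterministic dynamics\<close>

text \<open>During a merger different agents average different sets, and the leader enters some of
  the averages, so the mean is not an exact walk. What holds in every kind of state is
  \<open>\<phi>' \<ge> \<phi> + e / m\<close> up to arrival, where \<open>m\<close> counts the
  ordinary agents that agent 1 hears (\<open>peers\<close>, without the leader). This weight is read
  off the present state, hence determined by past noise, so the increments can be integrated one at
  a time by independence; merging times and group sizes never have to be computed.

  The obstacle is agent 1 being torn between its group and what lies ahead. For a cluster,
  \<open>2 * n * \<delta> \<le> \<epsilon>\<close> ends this after one step, because both sides give
  way. The leader does not give way, so there the situation can last; an upper bound on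
  \<open>A - \<phi>\<close> is then carried along, under which the pull on agent 1 offsets any noise
  until the rest of the group hears the leader too.

  Throughout, \<open>\<delta>\<close> is \<open>\<delta>2\<close>, which bounds the absolute value
  of the noise because \<open>\<delta>1 \<le> \<delta>2\<close>.\<close>

definition peers :: "nat \<Rightarrow> real \<Rightarrow> (agent \<Rightarrow> real) \<Rightarrow> nat \<Rightarrow> nat set" where
  "peers n \<epsilon> x i = {j \<in> {1..n}. \<bar>x (Ordinary j) - x (Ordinary i)\<bar> \<le> \<epsilon>}"

definition hk_mean :: "nat \<Rightarrow> real \<Rightarrow> (agent \<Rightarrow> real) \<Rightarrow> nat \<Rightarrow> real" where
  "hk_mean n \<epsilon> x i =
     1 / real (card (neighbors n \<epsilon> x i)) * (\<Sum>j\<in>neighbors n \<epsilon> x i. x j)"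

definition hk_step :: "nat \<Rightarrow> real \<Rightarrow> real \<Rightarrow> (agent \<Rightarrow> real) \<Rightarrow> (agent \<Rightarrow> real) \<Rightarrow> bool" where
  "hk_step n \<epsilon> e x x' \<longleftrightarrow> x' Leader = x Leader \<and>
     (\<forall>i\<in>{1..n}. x' (Ordinary i) = hk_mean n \<epsilon> x i + (if i = 1 then e else 0))"

lemma finite_peers [simp]: "finite (peers n \<epsilon> x i)"
  by (simp add: peers_def)

lemma neighbors_eq:
  "neighbors n \<epsilon> x i = Ordinary ` peers n \<epsilon> x i \<union>
     (if \<bar>x Leader - x (Ordinary i)\<bar> \<le> \<epsilon> then {Leader} else {})"
  by (auto simp: neighbors_def peers_def agents_def)

lemma hk_mean_unled:
  assumes "\<bar>x Leader - x (Ordinary i)\<bar> > \<epsilon>"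
  shows "hk_mean n \<epsilon> x i =
    (\<Sum>j\<in>peers n \<epsilon> x i. x (Ordinary j)) / real (card (peers n \<epsilon> x i))"
proof -
  have "neighbors n \<epsilon> x i = Ordinary ` peers n \<epsilon> x i"
    using assms by (auto simp: neighbors_eq)
  moreover have "inj_on Ordinary (peers n \<epsilon> x i)"
    by (auto simp: inj_on_def)
  ultimately show ?thesis
    by (simp add: hk_mean_def card_image sum.reindex)
qed

lemma hk_mean_led:
  assumes "\<bar>x Leader - x (Ordinary i)\<bar> \<le> \<epsilon>"
  shows "hk_mean n \<epsilon> x i =
    ((\<Sum>j\<in>peers n \<epsilon> x i. x (Ordinary j)) + x Leader) / (real (card (peers n \<epsilon> x i)) + 1)"
proof -
  have *: "neighbors n \<epsilon> x i = insert Leader (Ordinary ` peers n \<epsilon> x i)"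
    using assms by (auto simp: neighbors_eq)
  have "inj_on Ordinary (peers n \<epsilon> x i)" "Leader \<notin> Ordinary ` peers n \<epsilon> x i"
    by (auto simp: inj_on_def)
  then show ?thesis
    unfolding hk_mean_def *
    by (simp add: card_image sum.reindex add.commute)
qed

section \<open>Clusters, the growing group of agent 1, and the states it passes through\<close>

locale divisive_clusters =
  fixes n Nc :: nat and \<epsilon> A \<delta> :: real and V :: "nat \<Rightarrow> nat set" and xs :: "nat \<Rightarrow> real"
  assumes eps: "\<epsilon> > 0"
    and delta_pos: "\<delta> > 0" and delta_le: "\<delta> \<le> \<epsilon> / (2 * real n)"
    and Nc_ge: "2 \<le> Nc" and Nc_le: "Nc \<le> n"
    and cover: "(\<Union>g\<in>{1..Nc}. V g) = {1..n}"
    and nonempty: "g \<in> {1..Nc} \<Longrightarrow> V g \<noteq> {}"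
    and disj: "disjoint_family_on V {1..Nc}"
    and gap: "1 \<le> q \<Longrightarrow> q < p \<Longrightarrow> p \<le> Nc \<Longrightarrow> xs p - xs q > \<epsilon>"
    and agent1: "1 \<in> V 1"
    and leader_far: "A > xs Nc + \<epsilon>"
begin

definition grp :: "nat \<Rightarrow> nat set" where
  "grp k = (\<Union>g\<in>{1..k}. V g)"

text \<open>The obstacle ahead of the group: the next cluster or, once all clusters are absorbed,
  the leader.\<close>

definition nxt :: "nat \<Rightarrow> real" where
  "nxt k = (if k < Nc then xs (Suc k) else A)"

definition resting :: "nat \<Rightarrow> (agent \<Rightarrow> real) \<Rightarrow> bool" where
  "resting k x \<longleftrightarrow> x Leader = A \<and> (\<forall>g. k < g \<and> g \<le> Nc \<longrightarrow> (\<forall>i\<in>V g. x (Ordinary i) = xs g))"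

text \<open>In the three kinds of states below, \<open>\<phi>\<close> is the mean of the group, which is the next opinion
  of its members other than agent 1. If agent 1 is the only member, \<open>y\<close> is a dummy.\<close>

definition clique :: "nat \<Rightarrow> (agent \<Rightarrow> real) \<Rightarrow> real \<Rightarrow> bool" where
  "clique k x \<phi> \<longleftrightarrow> 1 \<le> k \<and> k \<le> Nc \<and> resting k x \<and>
     (\<forall>i\<in>grp k. \<forall>j\<in>grp k. \<bar>x (Ordinary i) - x (Ordinary j)\<bar> \<le> \<epsilon>) \<and>
     (\<forall>i\<in>grp k. x (Ordinary i) < nxt k - \<epsilon>) \<and>
     \<phi> = (\<Sum>i\<in>grp k. x (Ordinary i)) / real (card (grp k))"

definition bridging :: "nat \<Rightarrow> (agent \<Rightarrow> real) \<Rightarrow> real \<Rightarrow> bool" where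
  "bridging k x \<phi> \<longleftrightarrow> 1 \<le> k \<and> k < Nc \<and> resting k x \<and>
     (\<exists>y. (\<forall>i\<in>grp k - {1}. x (Ordinary i) = y) \<and> y < nxt k - \<epsilon> \<and>
       nxt k - \<epsilon> \<le> x (Ordinary 1) \<and> x (Ordinary 1) \<le> y + \<delta> \<and>
       \<phi> = y + (x (Ordinary 1) - y) / real (card (grp k)))"

definition pulled :: "(agent \<Rightarrow> real) \<Rightarrow> real \<Rightarrow> bool" where
  "pulled x \<phi> \<longleftrightarrow> x Leader = A \<and>
     (\<exists>y. (\<forall>i\<in>{1..n} - {1}. x (Ordinary i) = y) \<and> y < A - \<epsilon> \<and>
       \<bar>A - x (Ordinary 1)\<bar> \<le> \<epsilon> \<and> \<bar>x (Ordinary 1) - y\<bar> \<le> \<epsilon> \<and>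
       \<phi> = y + (x (Ordinary 1) - y) / real n \<and> A - \<phi> \<le> \<epsilon> + \<delta> * (1 - 1 / real n))"

definition tracked :: "(agent \<Rightarrow> real) \<Rightarrow> real \<Rightarrow> bool" where
  "tracked x \<phi> \<longleftrightarrow> (\<exists>k. clique k x \<phi>) \<or> (\<exists>k. bridging k x \<phi>) \<or> pulled x \<phi>"

lemma n_ge: "2 \<le> n"
  using Nc_ge Nc_le by simp

lemma delta_n: "2 * real n * \<delta> \<le> \<epsilon>"
  using delta_le n_ge by (simp add: pos_le_divide_eq mult.commute)

lemma delta_le_eps: "4 * \<delta> \<le> \<epsilon>"
proof -
  have "4 * \<delta> \<le> 2 * real n * \<delta>"
    using n_ge delta_pos by (intro mult_right_mono) auto
  then show ?thesis using delta_n by linarith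
qed

lemma grp_subset: "k \<le> Nc \<Longrightarrow> grp k \<subseteq> {1..n}"
  using cover by (fastforce simp: grp_def)

lemma finite_grp: "k \<le> Nc \<Longrightarrow> finite (grp k)"
  using grp_subset finite_subset by blast

lemma one_in_grp: "1 \<le> k \<Longrightarrow> 1 \<in> grp k"
  using agent1 by (force simp: grp_def)

lemma card_grp_pos: "1 \<le> k \<Longrightarrow> k \<le> Nc \<Longrightarrow> 1 \<le> card (grp k)"
  using one_in_grp finite_grp by (metis One_nat_def Suc_leI card_gt_0_iff empty_iff)

lemma card_grp_le: "k \<le> Nc \<Longrightarrow> card (grp k) \<le> n"
  using card_mono[OF _ grp_subset, of k] by simp

lemma grp_Nc: "grp Nc = {1..n}"
  using cover by (simp add: grp_def)

lemma V_subset: "g \<in> {1..Nc} \<Longrightarrow> V g \<subseteq> {1..n}"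
  using cover by blast

lemma grp_Suc: "grp (Suc k) = grp k \<union> V (Suc k)"
  by (auto simp: grp_def atLeastAtMostSuc_conv)

lemma grp_V_disjoint: "k < g \<Longrightarrow> g \<le> Nc \<Longrightarrow> grp k \<inter> V g = {}"
proof -
  assume g: "k < g" "g \<le> Nc"
  have "V h \<inter> V g = {}" if "h \<in> {1..k}" for h
    using disjoint_family_onD[OF disj, of h g] that g by auto
  then show "grp k \<inter> V g = {}" unfolding grp_def by blast
qed

lemma nxt_le: "nxt k \<le> A" if "k \<le> Nc"
proof (cases "Suc k < Nc")
  case True
  then show ?thesis using gap[of "Suc k" Nc] leader_far eps by (simp add: nxt_def)
next
  case False
  then have "k = Nc \<or> Suc k = Nc" using that by auto
  then show ?thesis using leader_far eps by (auto simp: nxt_def)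
qed

lemma nxt_le_xs: "nxt k \<le> xs g" if "k < g" "g \<le> Nc"
  using gap[of "Suc k" g] that eps by (cases "g = Suc k") (auto simp: nxt_def)

text \<open>A group that has absorbed the cluster at \<open>nxt k\<close> and lies at or below this
  value is still out of reach of the following obstacle, so obstacles are met one at a time.\<close>

lemma nxt_Suc: "nxt k < nxt (Suc k) - \<epsilon>" if "k < Nc"
proof (cases "Suc k < Nc")
  case True
  then show ?thesis using gap[of "Suc k" "Suc (Suc k)"] by (simp add: nxt_def)
next
  case False
  then have "Suc k = Nc" using that by auto
  then show ?thesis using leader_far by (auto simp: nxt_def)
qed

lemma outside_grp:
  assumes "resting k x" "j \<in> {1..n}" "j \<notin> grp k"
  shows "nxt k \<le> x (Ordinary j)"
proof -
  obtain g where g: "g \<in> {1..Nc}" "j \<in> V g" using assms(2) cover by blast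
  then have "k < g" using assms(3) by (force simp: grp_def)
  then show ?thesis using g assms(1) nxt_le_xs[of k g] by (auto simp: resting_def)
qed

lemma peers_subset_grp:
  assumes "resting k x" "x (Ordinary i) < nxt k - \<epsilon>"
  shows "peers n \<epsilon> x i \<subseteq> grp k"
proof
  fix j assume j: "j \<in> peers n \<epsilon> x i"
  show "j \<in> grp k"
  proof (rule ccontr)
    assume "j \<notin> grp k"
    then have "nxt k \<le> x (Ordinary j)" using outside_grp assms j by (auto simp: peers_def)
    then show False using j assms by (auto simp: peers_def)
  qed
qed

lemma resting_unled:
  assumes "resting k x" "k \<le> Nc" "x (Ordinary i) < nxt k - \<epsilon>"
  shows "\<bar>x Leader - x (Ordinary i)\<bar> > \<epsilon>"
  using assms nxt_le[of k] by (auto simp: resting_def)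

text \<open>Gaps between clusters exceed \<open>\<epsilon>\<close> and the leader is farther than
  \<open>\<epsilon>\<close> from even the last cluster, so a cluster that the group has not come
  near hears only itself.\<close>

lemma hk_mean_resting:
  assumes r: "resting k x" and k: "k < g" "g \<le> Nc" and i: "i \<in> V g"
    and away: "\<And>j. j \<in> grp k \<Longrightarrow> x (Ordinary j) < xs g - \<epsilon>"
  shows "hk_mean n \<epsilon> x i = xs g"
proof -
  have xg: "x (Ordinary j) = xs g'" if "k < g'" "g' \<le> Nc" "j \<in> V g'" for j g'
    using r that by (auto simp: resting_def)
  have fin: "finite (V g)" using V_subset[of g] k finite_subset by fastforce
  have P: "peers n \<epsilon> x i = V g"
  proof
    show "V g \<subseteq> peers n \<epsilon> x i"
      using V_subset[of g] k i xg[of g] eps by (auto simp: peers_def)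
    show "peers n \<epsilon> x i \<subseteq> V g"
    proof
      fix j assume j: "j \<in> peers n \<epsilon> x i"
      then have "j \<in> {1..n}" by (simp add: peers_def)
      then obtain g' where g': "g' \<in> {1..Nc}" "j \<in> V g'" using cover by blast
      have d: "\<bar>x (Ordinary j) - xs g\<bar> \<le> \<epsilon>" using j xg[OF k i] by (simp add: peers_def)
      have "g' > k"
      proof (rule ccontr)
        assume "\<not> g' > k"
        then have "j \<in> grp k" using g' by (auto simp: grp_def)
        from away[OF this] d show False by simp
      qed
      then have "\<bar>xs g' - xs g\<bar> \<le> \<epsilon>" using d xg[of g' j] g' by auto
      then have "g' = g" using gap[of g' g] gap[of g g'] g' k by (cases g' g rule: linorder_cases) auto
      then show "j \<in> V g" using g' by simp
    qed
  qed
  have "xs g + \<epsilon> < A"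
    using gap[of g Nc] k leader_far eps by (cases "g = Nc") auto
  then have "\<bar>x Leader - x (Ordinary i)\<bar> > \<epsilon>" using xg[OF k i] r by (simp add: resting_def)
  moreover have "card (V g) > 0" using i fin by (auto simp: card_gt_0_iff)
  moreover have "(\<Sum>j\<in>V g. x (Ordinary j)) = (\<Sum>j\<in>V g. xs g)"
    using xg[OF k] by (intro sum.cong) auto
  ultimately show ?thesis by (simp add: hk_mean_unled P)
qed

section \<open>One step of an isolated group\<close>

lemma clique_peers:
  assumes c: "clique k x \<phi>" and i: "i \<in> grp k"
  shows "peers n \<epsilon> x i = grp k"
proof
  show "peers n \<epsilon> x i \<subseteq> grp k"
    using c i by (intro peers_subset_grp) (auto simp: clique_def)
  show "grp k \<subseteq> peers n \<epsilon> x i"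
    using c i grp_subset[of k] unfolding clique_def peers_def by blast
qed

lemma clique_mean:
  assumes c: "clique k x \<phi>" and i: "i \<in> grp k"
  shows "hk_mean n \<epsilon> x i = \<phi>"
  using assms resting_unled[of k x i]
  by (auto simp: hk_mean_unled clique_peers[OF c i] clique_def)

lemma clique_lt:
  assumes c: "clique k x \<phi>"
  shows "\<phi> < nxt k - \<epsilon>"
proof -
  have k: "1 \<le> k" "k \<le> Nc" using c by (auto simp: clique_def)
  have "(\<Sum>i\<in>grp k. x (Ordinary i)) < (\<Sum>i\<in>grp k. nxt k - \<epsilon>)"
    using c finite_grp[of k] one_in_grp[of k] k by (intro sum_strict_mono) (auto simp: clique_def)
  then have "(\<Sum>i\<in>grp k. x (Ordinary i)) < (nxt k - \<epsilon>) * real (card (grp k))"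
    by (simp add: mult.commute)
  moreover have "\<phi> = (\<Sum>i\<in>grp k. x (Ordinary i)) / real (card (grp k))"
    using c by (simp add: clique_def)
  ultimately show ?thesis
    using card_grp_pos[OF k] by (simp add: pos_divide_less_eq)
qed

lemma sum_grp:
  assumes k: "1 \<le> k" "k \<le> Nc" and y: "\<And>i. i \<in> grp k - {1} \<Longrightarrow> f i = y"
  shows "(\<Sum>i\<in>grp k. f i) = (real (card (grp k)) - 1) * y + (f 1 :: real)"
proof -
  have "(\<Sum>i\<in>grp k. f i) = f 1 + (\<Sum>i\<in>grp k - {1}. f i)"
    using sum.remove[OF finite_grp one_in_grp] k by blast
  also have "(\<Sum>i\<in>grp k - {1}. f i) = (\<Sum>i\<in>grp k - {1}. y)"
    using y by (intro sum.cong) auto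
  also have "\<dots> = (real (card (grp k)) - 1) * y"
    using card_grp_pos[OF k] one_in_grp k by (simp add: of_nat_diff)
  finally show ?thesis by simp
qed

lemma resting_step_clique:
  assumes c: "clique k x \<phi>" and s: "hk_step n \<epsilon> e x x'"
  shows "resting k x'"
proof -
  have k: "1 \<le> k" "k \<le> Nc" and r: "resting k x" using c by (auto simp: clique_def)
  have "x' (Ordinary i) = xs g" if g: "k < g" "g \<le> Nc" "i \<in> V g" for i g
  proof -
    have "i \<in> {1..n}" using V_subset[of g] g by auto
    moreover have "i \<noteq> 1" using grp_V_disjoint[of k g] one_in_grp k g by auto
    moreover have "hk_mean n \<epsilon> x i = xs g"
    proof (rule hk_mean_resting[OF r g])
      fix j assume "j \<in> grp k"
      then have "x (Ordinary j) < nxt k - \<epsilon>" using c by (auto simp: clique_def)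
      then show "x (Ordinary j) < xs g - \<epsilon>" using nxt_le_xs[of k g] g by simp
    qed
    ultimately show ?thesis using s by (auto simp: hk_step_def)
  qed
  then show ?thesis using s r by (auto simp: resting_def hk_step_def)
qed

lemma clique_step_values:
  assumes c: "clique k x \<phi>" and s: "hk_step n \<epsilon> e x x'" and i: "i \<in> grp k"
  shows "x' (Ordinary i) = \<phi> + (if i = 1 then e else 0)"
proof -
  have "i \<in> {1..n}" using i grp_subset[of k] c by (auto simp: clique_def)
  then show ?thesis using s clique_mean[OF c i] by (auto simp: hk_step_def)
qed

text \<open>All members hear the same set, so one step puts everyone at \<open>\<phi>\<close> except
  agent 1, and the mean moves by exactly \<open>e / m\<close>. The zero-mean case relies on this
  equality, where a lower bound would not do.\<close>

lemma clique_step_stay: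
  assumes c: "clique k x \<phi>" and s: "hk_step n \<epsilon> e x x'" and e: "\<bar>e\<bar> \<le> \<delta>"
    and lt: "\<phi> + e < nxt k - \<epsilon>"
  shows "clique k x' (\<phi> + e / real (card (grp k)))"
proof -
  have k: "1 \<le> k" "k \<le> Nc" using c by (auto simp: clique_def)
  note v = clique_step_values[OF c s]
  have "(\<Sum>i\<in>grp k. x' (Ordinary i)) = (real (card (grp k)) - 1) * \<phi> + (\<phi> + e)"
    using sum_grp[OF k, of "\<lambda>i. x' (Ordinary i)" \<phi>] v one_in_grp[OF k(1)] by auto
  then have "\<phi> + e / real (card (grp k)) = (\<Sum>i\<in>grp k. x' (Ordinary i)) / real (card (grp k))"
    using card_grp_pos[OF k] by (simp add: field_simps)
  moreover have "\<bar>x' (Ordinary i) - x' (Ordinary j)\<bar> \<le> \<epsilon>" if "i \<in> grp k" "j \<in> grp k" for i j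
    using v that e delta_le_eps delta_pos by auto
  moreover have "x' (Ordinary i) < nxt k - \<epsilon>" if "i \<in> grp k" for i
    using v that lt clique_lt[OF c] by auto
  ultimately show ?thesis
    unfolding clique_def using k resting_step_clique[OF c s] by blast
qed

text \<open>Only agent 1 can cross \<open>nxt k - \<epsilon>\<close>, since the others land on
  \<open>\<phi>\<close>. Crossing starts a merger or, after the last merger, contact with the
  leader.\<close>

lemma clique_step:
  assumes c: "clique k x \<phi>" and s: "hk_step n \<epsilon> e x x'" and e: "\<bar>e\<bar> \<le> \<delta>"
  shows "tracked x' (\<phi> + e / real (card (peers n \<epsilon> x 1)))"
proof -
  have k: "1 \<le> k" "k \<le> Nc" using c by (auto simp: clique_def)
  note v = clique_step_values[OF c s]
  have P: "peers n \<epsilon> x 1 = grp k" using clique_peers[OF c] one_in_grp[OF k(1)] .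
  have x1: "x' (Ordinary 1) = \<phi> + e" using v one_in_grp[OF k(1)] by auto
  have others: "\<forall>i\<in>grp k - {1}. x' (Ordinary i) = \<phi>" using v by auto
  have r: "resting k x'" by (rule resting_step_clique[OF c s])
  note lt = clique_lt[OF c]
  consider "\<phi> + e < nxt k - \<epsilon>" | "nxt k - \<epsilon> \<le> \<phi> + e" "k < Nc" | "nxt k - \<epsilon> \<le> \<phi> + e" "k = Nc"
    using k by linarith
  then show ?thesis
  proof cases
    case 1
    from clique_step_stay[OF c s e this] show ?thesis unfolding tracked_def P by blast
  next
    case 2
    then have "bridging k x' (\<phi> + e / real (card (grp k)))"
      unfolding bridging_def using k r others lt x1 e
      by (intro conjI exI[of _ \<phi>]) auto
    then show ?thesis unfolding tracked_def P by blast
  next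
    case 3
    have nA: "nxt k = A" using 3 by (simp add: nxt_def)
    \<comment> \<open>Crossing gives \<open>A - \<phi> - e \<le> \<epsilon>\<close>, but the mean
      advances only by \<open>e / n\<close>, which leaves it at most
      \<open>\<epsilon> + e * (1 - 1 / n)\<close> short of \<open>A\<close>. This is the origin of
      the last bound in \<open>pulled\<close>.\<close>
    have "e * (1 - 1 / real n) \<le> \<delta> * (1 - 1 / real n)"
      using e n_ge by (intro mult_right_mono) auto
    then have "A - (\<phi> + e / real n) \<le> \<epsilon> + \<delta> * (1 - 1 / real n)"
      using 3 nA by (simp add: algebra_simps)
    then have "pulled x' (\<phi> + e / real n)"
      unfolding pulled_def using r others lt x1 e 3 nA grp_Nc delta_le_eps delta_pos
      by (intro conjI exI[of _ \<phi>]) (auto simp: resting_def)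
    moreover have "card (peers n \<epsilon> x 1) = n" using P 3 grp_Nc by simp
    ultimately show ?thesis by (simp add: tracked_def)
  qed
qed

lemma clique_le: "clique k x \<phi> \<Longrightarrow> \<phi> \<le> A"
  using clique_lt[of k x \<phi>] nxt_le[of k] eps by (auto simp: clique_def)

text \<open>The ceiling for the accumulated drift. In the two states other than a clique,
  \<open>\<phi>\<close> lies between \<open>y\<close> and the opinion of agent 1, which exceeds
  \<open>y\<close> by at most \<open>\<epsilon>\<close>, while
  \<open>y < A - \<epsilon>\<close>.\<close>

lemma tracked_le: "tracked x \<phi> \<Longrightarrow> \<phi> \<le> A"
  unfolding tracked_def
proof (elim disjE exE)
  fix k assume "clique k x \<phi>" then show ?thesis by (rule clique_le)
next
  fix k assume b: "bridging k x \<phi>"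
  then obtain y where y: "y < nxt k - \<epsilon>" "nxt k - \<epsilon> \<le> x (Ordinary 1)" "x (Ordinary 1) \<le> y + \<delta>"
      "\<phi> = y + (x (Ordinary 1) - y) / real (card (grp k))" and k: "1 \<le> k" "k < Nc"
    by (auto simp: bridging_def)
  have "(x (Ordinary 1) - y) / real (card (grp k)) \<le> (x (Ordinary 1) - y) / 1"
    using y card_grp_pos[of k] k by (intro divide_left_mono) auto
  then show ?thesis using y nxt_le[of k] k delta_le_eps delta_pos by auto
next
  assume "pulled x \<phi>"
  then obtain y where y: "y < A - \<epsilon>" "\<bar>x (Ordinary 1) - y\<bar> \<le> \<epsilon>" "\<bar>A - x (Ordinary 1)\<bar> \<le> \<epsilon>"
      "\<phi> = y + (x (Ordinary 1) - y) / real n"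
    by (auto simp: pulled_def)
  have "(x (Ordinary 1) - y) / real n \<le> (x (Ordinary 1) - y) / 1"
    using y n_ge by (intro divide_left_mono) auto
  then show ?thesis using y by auto
qed

text \<open>Agent 1 averages the group together with the leader; the others average the group alone
  and move to \<open>\<phi>\<close>. If \<open>\<phi>\<close> is within \<open>\<epsilon>\<close> of
  \<open>A\<close>, everyone is close to the leader after the step. Otherwise the pull on agent 1
  outweighs any noise and the same kind of state recurs.\<close>

lemma pulled_step:
  assumes p: "pulled x \<phi>" and s: "hk_step n \<epsilon> e x x'" and e: "\<bar>e\<bar> \<le> \<delta>"
  shows "leader_dist n A x' \<le> \<epsilon> \<or> (\<exists>\<phi>'. \<phi> + e / real (card (peers n \<epsilon> x 1)) \<le> \<phi>' \<and> tracked x' \<phi>')"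
proof -
  obtain y where oth: "\<And>i. i \<in> {1..n} - {1} \<Longrightarrow> x (Ordinary i) = y" and yA: "y < A - \<epsilon>"
    and zA: "\<bar>A - x (Ordinary 1)\<bar> \<le> \<epsilon>" and zy: "\<bar>x (Ordinary 1) - y\<bar> \<le> \<epsilon>"
    and phi: "\<phi> = y + (x (Ordinary 1) - y) / real n"
    and u: "A - \<phi> \<le> \<epsilon> + \<delta> * (1 - 1 / real n)" and L: "x Leader = A"
    using p by (auto simp: pulled_def)
  have le: "\<phi> \<le> A" using p tracked_le by (auto simp: tracked_def)
  have P: "peers n \<epsilon> x i = {1..n}" if i: "i \<in> {1..n}" for i
  proof -
    have v: "x (Ordinary j) = (if j = 1 then x (Ordinary 1) else y)" if "j \<in> {1..n}" for j
      using oth[of j] that by auto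
    have "\<bar>x (Ordinary j) - x (Ordinary i)\<bar> \<le> \<epsilon>" if "j \<in> {1..n}" for j
      unfolding v[OF i] v[OF that] using zy eps by auto
    then show ?thesis by (auto simp: peers_def)
  qed
  have S: "(\<Sum>i\<in>{1..n}. x (Ordinary i)) = real n * \<phi>"
  proof -
    have "(\<Sum>i\<in>{1..n}. x (Ordinary i)) = (real n - 1) * y + x (Ordinary 1)"
      using sum_grp[of Nc "\<lambda>i. x (Ordinary i)" y] oth Nc_ge grp_Nc by auto
    then show ?thesis using n_ge phi by (simp add: field_simps)
  qed
  have y': "x' (Ordinary i) = \<phi>" if "i \<in> {1..n} - {1}" for i
  proof -
    have "\<bar>x Leader - x (Ordinary i)\<bar> > \<epsilon>" using oth[OF that] yA L by auto
    then show ?thesis using s that n_ge P S by (auto simp: hk_step_def hk_mean_unled)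
  qed
  have one: "1 \<in> {1..n}" using n_ge by simp
  have z': "x' (Ordinary 1) = A - real n / (real n + 1) * (A - \<phi>) + e"
  proof -
    have "hk_mean n \<epsilon> x 1 = (real n * \<phi> + A) / (real n + 1)"
      using zA L one P S by (simp add: hk_mean_led)
    then show ?thesis using s one by (simp add: hk_step_def field_simps)
  qed
  define N where "N = real n"
  define U where "U = A - \<phi>"
  have N: "N \<ge> 2" "2 * N * \<delta> \<le> \<epsilon>" using n_ge delta_n by (auto simp: N_def)
  have U: "0 \<le> U" "U \<le> \<epsilon> + \<delta> * (1 - 1 / N)" using le u by (auto simp: U_def N_def)
  have w: "A - x' (Ordinary 1) = U * N / (N + 1) - e"
    using z' by (simp add: U_def N_def)
  have w0: "0 \<le> U * N / (N + 1)" using N U by simp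
  \<comment> \<open>The bound in \<open>pulled\<close> is tuned to this point:
    \<open>(\<epsilon> - \<delta>) * (N + 1)\<close> minus
    \<open>\<epsilon> * N + \<delta> * (N - 1)\<close> is exactly
    \<open>\<epsilon> - 2 * N * \<delta>\<close>. Agent 1 thus keeps contact with the leader under
    any noise.\<close>
  have w1: "U * N / (N + 1) + \<delta> \<le> \<epsilon>"
  proof -
    have "U * N \<le> (\<epsilon> + \<delta> * (1 - 1 / N)) * N" using U N by (intro mult_right_mono) auto
    also have "\<dots> = \<epsilon> * N + \<delta> * (N - 1)" using N by (simp add: field_simps)
    also have "\<dots> \<le> (\<epsilon> - \<delta>) * (N + 1)" using N by (simp add: algebra_simps)
    finally show ?thesis using N by (simp add: field_simps)
  qed
  have z1: "\<bar>A - x' (Ordinary 1)\<bar> \<le> \<epsilon>" using w w0 w1 e delta_le_eps delta_pos by linarith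
  show ?thesis
  proof (cases "U \<le> \<epsilon>")
    case True
    have "leader_dist n A x' \<le> \<epsilon>"
      unfolding leader_dist_def
    proof (subst Max_le_iff; (intro ballI)?)
      fix a assume "a \<in> (\<lambda>i. \<bar>x' (Ordinary i) - A\<bar>) ` {1..n}"
      then obtain i where i: "i \<in> {1..n}" "a = \<bar>x' (Ordinary i) - A\<bar>" by auto
      show "a \<le> \<epsilon>"
      proof (cases "i = 1")
        case True then show ?thesis using z1 i by (simp add: abs_minus_commute)
      next
        case False then show ?thesis using y'[of i] i \<open>U \<le> \<epsilon>\<close> U by (auto simp: U_def)
      qed
    qed (use n_ge in auto)
    then show ?thesis ..
  next
    case False
    define \<phi>' where "\<phi>' = \<phi> + (x' (Ordinary 1) - \<phi>) / N"
    have d: "x' (Ordinary 1) - \<phi> = U / (N + 1) + e"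
      using w N unfolding U_def by (simp add: field_simps)
    have d0: "0 \<le> U / (N + 1)" using U N by simp
    have d1: "U / (N + 1) \<le> \<epsilon> / 2"
    proof -
      have "\<delta> * (1 - 1 / N) \<le> \<delta> * 1" using N delta_pos by (intro mult_left_mono) auto
      then have "U \<le> 3 * \<epsilon> / 2" using U delta_le_eps by simp
      also have "\<dots> \<le> \<epsilon> / 2 * (N + 1)" using N eps by (simp add: field_simps)
      finally show ?thesis using N by (simp add: field_simps)
    qed
    \<comment> \<open>Since \<open>U > \<epsilon> \<ge> 2 * N * \<delta> \<ge> (N + 1) *
      \<delta>\<close>, the pull offsets the worst noise. Hence \<open>\<phi>' \<ge> \<phi>\<close>,
      and the bound on the distance to \<open>A\<close> persists.\<close>
    have dd: "\<delta> \<le> U / (N + 1)"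
    proof -
      have "\<delta> * (N + 1) \<le> 2 * N * \<delta>" using N delta_pos by (simp add: algebra_simps)
      then have "\<delta> * (N + 1) \<le> U" using N False by simp
      then show ?thesis using N by (simp add: field_simps)
    qed
    have d2: "\<bar>x' (Ordinary 1) - \<phi>\<bar> \<le> \<epsilon>"
      unfolding d using d0 d1 e delta_le_eps delta_pos by linarith
    have ge: "\<phi> + e / N \<le> \<phi>'"
      unfolding \<phi>'_def d using d0 N by (simp add: divide_right_mono)
    have "0 \<le> (x' (Ordinary 1) - \<phi>) / N" using d dd e N by simp
    then have up: "A - \<phi>' \<le> \<epsilon> + \<delta> * (1 - 1 / N)" using U unfolding \<phi>'_def U_def by simp
    have "pulled x' \<phi>'"
      unfolding pulled_def using y' z1 d2 s L False up
      by (intro conjI exI[of _ \<phi>]) (auto simp: U_def N_def \<phi>'_def hk_step_def)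
    then show ?thesis using ge P[OF one] by (auto simp: tracked_def N_def)
  qed
qed

text \<open>Agent 1 hears both groups, the cluster hears agent 1 besides itself, and the rest of the
  old group hears only the old group. The three averages lie within \<open>\<epsilon>\<close> of
  each other even after the noise, so the next state is a clique. The weight is already that of the
  merged group because agent 1 hears all of it.\<close>

lemma bridging_step:
  assumes b: "bridging k x \<phi>" and s: "hk_step n \<epsilon> e x x'" and e: "\<bar>e\<bar> \<le> \<delta>"
  shows "\<exists>\<phi>'. \<phi> + e / real (card (peers n \<epsilon> x 1)) \<le> \<phi>' \<and> clique (Suc k) x' \<phi>'"
proof -
  obtain y where k: "1 \<le> k" "k < Nc" and r: "resting k x"
    and oth: "\<And>i. i \<in> grp k - {1} \<Longrightarrow> x (Ordinary i) = y"
    and yv: "y < nxt k - \<epsilon>" and zv: "nxt k - \<epsilon> \<le> x (Ordinary 1)"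
    and zy: "x (Ordinary 1) \<le> y + \<delta>"
    and phi: "\<phi> = y + (x (Ordinary 1) - y) / real (card (grp k))"
    using b by (auto simp: bridging_def)
  define z v where "z = x (Ordinary 1)" and "v = nxt k"
  define W where "W = V (Suc k)"
  define p q where "p = real (card (grp k))" and "q = real (card W)"
  note zv = zv[folded z_def v_def] and yv = yv[folded v_def] and zy = zy[folded z_def]
    and phi = phi[folded z_def p_def]
  have kN: "k \<le> Nc" "Suc k \<le> Nc" "Suc k \<in> {1..Nc}" using k by auto
  have W: "\<And>i. i \<in> W \<Longrightarrow> x (Ordinary i) = v"
    using r k by (auto simp: resting_def v_def W_def nxt_def)
  have Wn: "W \<subseteq> {1..n}" "finite W" "W \<noteq> {}"
    using V_subset[OF kN(3)] nonempty[OF kN(3)] finite_subset by (auto simp: W_def)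
  have gS: "grp (Suc k) = grp k \<union> W" and dj: "grp k \<inter> W = {}"
    using grp_Suc grp_V_disjoint[of k "Suc k"] k by (auto simp: W_def)
  have one: "1 \<in> grp k" "1 \<notin> W" using one_in_grp k dj by auto
  have gn: "grp k \<subseteq> {1..n}" and fg: "finite (grp k)" using grp_subset finite_grp kN by auto
  have cS: "real (card (grp (Suc k))) = p + q"
    unfolding gS p_def q_def using card_Un_disjoint[OF fg Wn(2) dj] by simp
  have p1: "1 \<le> p" and q1: "1 \<le> q"
    using card_grp_pos[of k] k Wn by (auto simp: p_def q_def Suc_le_eq card_gt_0_iff)
  have pq: "p + q \<le> real n" using card_grp_le[OF kN(2)] cS by simp
  have vS: "v < nxt (Suc k) - \<epsilon>" using nxt_Suc[of k] k by (simp add: v_def)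
  have zltv: "z < v" using zy yv delta_le_eps delta_pos by linarith
  have rS: "resting (Suc k) x" using r by (auto simp: resting_def)
  have vsub: "x (Ordinary i) \<le> v" if "i \<in> grp (Suc k)" for i
    using that oth[of i] W[of i] zltv yv eps unfolding gS by (cases "i = 1") (auto simp: z_def)
  have P1: "peers n \<epsilon> x 1 = grp (Suc k)"
  proof
    show "peers n \<epsilon> x 1 \<subseteq> grp (Suc k)"
      by (rule peers_subset_grp[OF rS]) (use zltv vS in \<open>simp add: z_def\<close>)
    show "grp (Suc k) \<subseteq> peers n \<epsilon> x 1"
    proof
      fix j assume j: "j \<in> grp (Suc k)"
      have "\<bar>x (Ordinary j) - z\<bar> \<le> \<epsilon>"
        using j oth[of j] W[of j] zy yv zv zltv delta_le_eps delta_pos unfolding gS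
        by (cases "j = 1") (auto simp: z_def)
      then show "j \<in> peers n \<epsilon> x 1" using j gS gn Wn by (auto simp: peers_def z_def)
    qed
  qed
  have Pg: "peers n \<epsilon> x i = grp k" if i: "i \<in> grp k - {1}" for i
  proof
    show "peers n \<epsilon> x i \<subseteq> grp k"
      by (rule peers_subset_grp[OF r]) (use oth[OF i] yv in \<open>simp add: v_def\<close>)
    show "grp k \<subseteq> peers n \<epsilon> x i"
    proof
      fix j assume j: "j \<in> grp k"
      have "\<bar>x (Ordinary j) - y\<bar> \<le> \<epsilon>"
        using j oth[of j] zy yv zv delta_le_eps delta_pos eps
        by (cases "j = 1") (auto simp: z_def)
      then show "j \<in> peers n \<epsilon> x i" using j gn oth[OF i] by (auto simp: peers_def)
    qed
  qed
  have PW: "peers n \<epsilon> x i = insert 1 W" if i: "i \<in> W" for i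
  proof
    show "peers n \<epsilon> x i \<subseteq> insert 1 W"
    proof
      fix j assume j: "j \<in> peers n \<epsilon> x i"
      have "j \<in> grp (Suc k)" using peers_subset_grp[OF rS, of i] W[OF i] vS j by auto
      moreover have "j \<notin> grp k - {1}"
      proof
        assume "j \<in> grp k - {1}"
        then show False using j oth[of j] W[OF i] yv unfolding peers_def by auto
      qed
      ultimately show "j \<in> insert 1 W" using gS by auto
    qed
    show "insert 1 W \<subseteq> peers n \<epsilon> x i"
      using W i Wn one gn zv zltv eps by (auto simp: peers_def z_def)
  qed
  have Sg: "(\<Sum>i\<in>grp k. x (Ordinary i)) = p * \<phi>"
  proof -
    have "(\<Sum>i\<in>grp k. x (Ordinary i)) = (p - 1) * y + z"
      using sum_grp[of k "\<lambda>i. x (Ordinary i)" y] oth k by (simp add: p_def z_def)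
    then show ?thesis using p1 phi by (simp add: field_simps)
  qed
  have SW: "(\<Sum>i\<in>W. x (Ordinary i)) = q * v"
    using W by (simp add: q_def)
  have SgW: "(\<Sum>i\<in>grp (Suc k). x (Ordinary i)) = p * \<phi> + q * v"
    unfolding gS using sum.union_disjoint[OF fg Wn(2) dj, of "\<lambda>i. x (Ordinary i)"] Sg SW by simp
  have unled: "\<bar>x Leader - x (Ordinary i)\<bar> > \<epsilon>" if "i \<in> grp (Suc k)" for i
    using resting_unled[OF rS, of i] vsub[OF that] vS k by auto
  \<comment> \<open>Noise-free next opinions of agent 1 (\<open>\<beta>\<close>) and of the absorbed
    cluster (\<open>v'\<close>); the others move to \<open>\<phi>\<close>.\<close>
  define \<beta> where "\<beta> = (p * \<phi> + q * v) / (p + q)"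
  define v' where "v' = (z + q * v) / (q + 1)"
  have z': "x' (Ordinary 1) = \<beta> + e"
    using s unled[of 1] P1 SgW cS one gn n_ge
    by (auto simp: hk_step_def hk_mean_unled \<beta>_def gS)
  have y': "x' (Ordinary i) = \<phi>" if i: "i \<in> grp k - {1}" for i
    using s unled[of i] Pg[OF i] Sg p1 i gn gS
    by (auto simp: hk_step_def hk_mean_unled p_def)
  have W': "x' (Ordinary i) = v'" if i: "i \<in> W" for i
  proof -
    have "i \<noteq> 1" using one i by auto
    then show ?thesis
      using s unled[of i] PW[OF i] SW i Wn gS one
      by (auto simp: hk_step_def hk_mean_unled v'_def q_def z_def add.commute)
  qed
  have r': "resting (Suc k) x'"
  proof -
    have "x' (Ordinary i) = xs g" if g: "Suc k < g" "g \<le> Nc" "i \<in> V g" for i g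
    proof -
      have "i \<in> {1..n}" using V_subset[of g] g by auto
      moreover have "i \<noteq> 1" using grp_V_disjoint[of k g] one g by auto
      moreover have "hk_mean n \<epsilon> x i = xs g"
      proof (rule hk_mean_resting[OF rS g])
        fix j assume "j \<in> grp (Suc k)"
        then show "x (Ordinary j) < xs g - \<epsilon>"
          using vsub vS nxt_le_xs[of "Suc k" g] g by force
      qed
      ultimately show ?thesis using s by (auto simp: hk_step_def)
    qed
    then show ?thesis using s r by (auto simp: resting_def hk_step_def)
  qed
  define D where "D = v - \<phi>"
  have n\<delta>: "2 * real n * \<delta> \<le> \<epsilon>" by (rule delta_n)
  have zy0: "0 \<le> z - y" using zv yv by simp
  have phiz: "\<phi> \<le> z" "y \<le> \<phi>"
  proof -
    have "(z - y) / p \<le> (z - y) / 1" using zy0 p1 by (intro divide_left_mono) auto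
    then show "\<phi> \<le> z" using phi by simp
    show "y \<le> \<phi>" using phi zy0 p1 by simp
  qed
  have D: "\<epsilon> - \<delta> \<le> D" "D \<le> \<epsilon> + \<delta>"
    unfolding D_def using phiz zv zy yv by auto
  have \<beta>1: "\<beta> - \<phi> = D * (q / (p + q))" and \<beta>2: "v - \<beta> = D * (p / (p + q))"
    unfolding \<beta>_def D_def using p1 q1 by (simp_all add: field_simps)
  have n2: "2 \<le> real n" using n_ge by simp
  \<comment> \<open>\<open>\<beta>\<close> divides the gap \<open>D\<close> in the ratio
    \<open>q : p\<close>, and each share is at most \<open>1 - 1 / n\<close> because
    \<open>p, q \<ge> 1\<close> and \<open>p + q \<le> n\<close>. The part
    \<open>(\<epsilon> + \<delta>) / n \<ge> 2 * \<delta>\<close> left over from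
    \<open>D \<le> \<epsilon> + \<delta>\<close> pays for the excess \<open>\<delta>\<close> and for
    the noise.\<close>
  have frac: "D * t + \<delta> \<le> \<epsilon>" if t: "0 \<le> t" "t \<le> 1 - 1 / real n" for t
  proof -
    have "D * t \<le> (\<epsilon> + \<delta>) * (1 - 1 / real n)"
      using D t eps delta_pos n2 by (intro mult_mono) auto
    also have "\<dots> = \<epsilon> + \<delta> - (\<epsilon> + \<delta>) / real n" by (simp add: algebra_simps add_divide_distrib)
    also have "2 * \<delta> \<le> (\<epsilon> + \<delta>) / real n"
      using n\<delta> delta_pos n2 by (simp add: field_simps)
    then have "\<epsilon> + \<delta> - (\<epsilon> + \<delta>) / real n \<le> \<epsilon> - \<delta>" by simp
    finally show ?thesis by simp
  qed
  have inv_n: "1 / real n \<le> 1 / (p + q)" using pq p1 q1 by (intro divide_left_mono) auto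
  have tq: "q / (p + q) \<le> 1 - 1 / real n" and tp: "p / (p + q) \<le> 1 - 1 / real n"
  proof -
    have "q / (p + q) = 1 - p / (p + q)" "p / (p + q) = 1 - q / (p + q)"
      using p1 q1 by (simp_all add: field_simps)
    moreover have "1 / (p + q) \<le> p / (p + q)" "1 / (p + q) \<le> q / (p + q)"
      using p1 q1 by (simp_all add: divide_right_mono)
    ultimately have "q / (p + q) \<le> 1 - 1 / (p + q)" "p / (p + q) \<le> 1 - 1 / (p + q)"
      by linarith+
    then show "q / (p + q) \<le> 1 - 1 / real n" "p / (p + q) \<le> 1 - 1 / real n"
      using inv_n by linarith+
  qed
  have b1: "\<beta> - \<phi> + \<delta> \<le> \<epsilon>" unfolding \<beta>1 using frac[OF _ tq] p1 q1 by simp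
  have b2: "v - \<beta> + \<delta> \<le> \<epsilon>" unfolding \<beta>2 using frac[OF _ tp] p1 q1 by simp
  have b0: "\<phi> \<le> \<beta>"
  proof -
    have "0 \<le> \<beta> - \<phi>" unfolding \<beta>1 using D delta_le_eps delta_pos p1 q1 by simp
    then show ?thesis by simp
  qed
  \<comment> \<open>Even with noise agent 1 stays at or below \<open>v\<close>, which keeps the
    merged group away from the following obstacle.\<close>
  have b3: "\<beta> + \<delta> \<le> v"
  proof -
    have "\<delta> \<le> (\<epsilon> - \<delta>) * (1 / real n)"
    proof -
      have "\<delta> * real n + \<delta> \<le> \<delta> * real n + \<delta> * real n"
        using n2 delta_pos by simp
      then have "\<delta> * real n \<le> \<epsilon> - \<delta>" using n\<delta> by (simp add: mult.commute)
      then show ?thesis using n2 by (simp add: field_simps)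
    qed
    also have "\<dots> \<le> D * (p / (p + q))"
    proof (intro mult_mono)
      have "1 / (p + q) \<le> p / (p + q)" using p1 q1 by (intro divide_right_mono) auto
      then show "1 / real n \<le> p / (p + q)" using inv_n by simp
    qed (use D delta_le_eps delta_pos in auto)
    finally show ?thesis using \<beta>2 by simp
  qed
  have v1: "v' \<le> v" "z \<le> v'"
    unfolding v'_def using zltv q1 by (simp_all add: field_simps)
  \<comment> \<open>Averaging with agent 1 leaves the cluster at most
    \<open>(1 - 1 / n) * \<epsilon>\<close> to the right of \<open>z\<close>, and
    \<open>z - \<phi> \<le> \<delta> \<le> \<epsilon> / n\<close> fits into the rest.\<close>
  have v2: "v' - \<phi> \<le> \<epsilon>" if "i \<in> grp k - {1}" for i
  proof -
    have "v' - \<phi> = (v - z) * (q / (q + 1)) + (z - \<phi>)"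
      unfolding v'_def using q1 by (simp add: field_simps)
    moreover have "(v - z) * (q / (q + 1)) \<le> \<epsilon> * (1 - 1 / real n)"
    proof (intro mult_mono)
      have "q / (q + 1) = 1 - 1 / (q + 1)" using q1 by (simp add: field_simps)
      moreover have "1 / real n \<le> 1 / (q + 1)" using pq p1 q1 by (intro divide_left_mono) auto
      ultimately show "q / (q + 1) \<le> 1 - 1 / real n" by simp
    qed (use zv zltv eps q1 in auto)
    moreover have "z - \<phi> \<le> \<delta>" using phiz zy by simp
    moreover have "\<delta> * real n \<le> \<epsilon>"
    proof -
      have "2 * (\<delta> * real n) \<le> \<epsilon>" using n\<delta> by (simp add: ac_simps)
      moreover have "0 \<le> \<delta> * real n" using delta_pos by simp
      ultimately show ?thesis by linarith
    qed
    then have "\<epsilon> * (1 - 1 / real n) + \<delta> \<le> \<epsilon>"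
      using n2 by (simp add: field_simps)
    ultimately show ?thesis by linarith
  qed
  have pairs: "\<bar>x' (Ordinary i) - x' (Ordinary j)\<bar> \<le> \<epsilon>"
    if ij: "i \<in> grp (Suc k)" "j \<in> grp (Suc k)" for i j
  proof -
    have "v' - (\<beta> + e) \<le> \<epsilon>" "(\<beta> + e) - v' \<le> \<epsilon>" "\<bar>\<phi> - (\<beta> + e)\<bar> \<le> \<epsilon>"
      using b1 b2 b3 b0 v1 e delta_le_eps delta_pos zv by linarith+
    note ineqs = this
    have mixed: "\<bar>v' - \<phi>\<bar> \<le> \<epsilon>" if "i \<in> grp k - {1}" for i
      using v2[OF that] v1 phiz eps by linarith
    have ci: "i = 1 \<or> i \<in> grp k - {1} \<or> i \<in> W" and cj: "j = 1 \<or> j \<in> grp k - {1} \<or> j \<in> W"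
      using ij gS by auto
    from ci show ?thesis
    proof (elim disjE)
      assume i: "i = 1"
      from cj show ?thesis
        by (elim disjE) (use i y' W' z' ineqs eps in auto)
    next
      assume i: "i \<in> grp k - {1}"
      from cj show ?thesis
        by (elim disjE) (use y'[OF i] y' W' z' ineqs mixed[OF i] eps in \<open>auto simp: abs_minus_commute\<close>)
    next
      assume i: "i \<in> W"
      from cj show ?thesis
        by (elim disjE) (use W'[OF i] y' W' z' ineqs mixed eps in auto)
    qed
  qed
  have below: "x' (Ordinary i) < nxt (Suc k) - \<epsilon>" if i: "i \<in> grp (Suc k)" for i
  proof -
    consider "i = 1" | "i \<in> grp k - {1}" | "i \<in> W" using i gS by auto
    then have "x' (Ordinary i) \<le> v"
    proof cases
      case 1 then show ?thesis using z' b3 e by simp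
    next
      case 2 then show ?thesis using y' phiz zltv by simp
    next
      case 3 then show ?thesis using W' v1 by simp
    qed
    then show ?thesis using vS by simp
  qed
  define \<phi>' where "\<phi>' = (\<Sum>i\<in>grp (Suc k). x' (Ordinary i)) / real (card (grp (Suc k)))"
  have "clique (Suc k) x' \<phi>'"
    unfolding clique_def by (intro conjI ballI kN r' pairs below \<phi>'_def) auto
  moreover have "\<phi> + e / (p + q) \<le> \<phi>'"
  proof -
    have "(\<Sum>i\<in>grp k. x' (Ordinary i)) = (p - 1) * \<phi> + (\<beta> + e)"
      using sum_grp[of k "\<lambda>i. x' (Ordinary i)" \<phi>] y' z' k by (simp add: p_def)
    moreover have "(\<Sum>i\<in>W. x' (Ordinary i)) = q * v'"
      using W' by (simp add: q_def)
    ultimately have "(\<Sum>i\<in>grp (Suc k). x' (Ordinary i)) = (p - 1) * \<phi> + (\<beta> + e) + q * v'"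
      unfolding gS using sum.union_disjoint[OF fg Wn(2) dj, of "\<lambda>i. x' (Ordinary i)"] by simp
    \<comment> \<open>Equality is given up here: \<open>\<beta>\<close> and \<open>v'\<close> are
      lowered to \<open>\<phi>\<close>, and the discarded surplus is the gain from the
      merger.\<close>
    also have "\<dots> \<ge> (p - 1) * \<phi> + (\<phi> + e) + q * \<phi>"
      using b0 v1 phiz p1 q1 by (intro add_mono mult_left_mono) auto
    finally have "(p + q) * \<phi> + e \<le> (\<Sum>i\<in>grp (Suc k). x' (Ordinary i))"
      by (simp add: algebra_simps)
    then have "((p + q) * \<phi> + e) / (p + q) \<le> \<phi>'"
      unfolding \<phi>'_def cS using p1 q1 by (intro divide_right_mono) auto
    moreover have "((p + q) * \<phi> + e) / (p + q) = \<phi> + e / (p + q)"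
      using p1 q1 by (simp add: add_divide_distrib)
    ultimately show ?thesis by simp
  qed
  ultimately show ?thesis using P1 cS by auto
qed

section \<open>From single steps to whole trajectories\<close>

lemma tracked_step:
  assumes t: "tracked x \<phi>" and s: "hk_step n \<epsilon> e x x'" and e: "\<bar>e\<bar> \<le> \<delta>"
  shows "leader_dist n A x' \<le> \<epsilon> \<or> (\<exists>\<phi>'. \<phi> + e / real (card (peers n \<epsilon> x 1)) \<le> \<phi>' \<and> tracked x' \<phi>')"
  using t clique_step[OF _ s e] bridging_step[OF _ s e] pulled_step[OF _ s e]
  unfolding tracked_def by (meson order_refl)

lemma clique_initial:
  assumes "divisive_initial n \<epsilon> Nc V xs x" and "x Leader = A"
  shows "clique 1 x (xs 1)"
proof -
  have x: "x (Ordinary i) = xs g" if "g \<in> {1..Nc}" "i \<in> V g" for i g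
    using assms that by (auto simp: divisive_initial_def)
  then have x1: "x (Ordinary i) = xs 1" if "i \<in> V 1" for i
    using that Nc_ge by simp
  have g1: "grp 1 = V 1" by (simp add: grp_def)
  have "xs 1 < nxt 1 - \<epsilon>" using gap[of 1 2] Nc_ge by (simp add: nxt_def numeral_2_eq_2)
  moreover have "1 \<in> {1..Nc}" using Nc_ge by simp
  moreover have "(\<Sum>i\<in>V 1. x (Ordinary i)) = (\<Sum>i\<in>V 1. xs 1)"
    using x1 by (intro sum.cong) auto
  moreover have "card (V 1) > 0"
    using card_grp_pos[of 1] Nc_ge g1 by simp
  moreover have "resting 1 x" using x assms(2) by (auto simp: resting_def)
  ultimately show ?thesis
    using x1 eps unfolding clique_def g1 by auto
qed

text \<open>The last cluster is still in its initial place, too far from the leader.\<close>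

lemma clique_far:
  assumes "clique k x \<phi>" "k < Nc"
  shows "\<not> leader_dist n A x \<le> \<epsilon>"
proof -
  obtain i where i: "i \<in> V Nc" using nonempty[of Nc] Nc_ge by auto
  have "x (Ordinary i) = xs Nc" using assms i by (auto simp: clique_def resting_def)
  moreover have "i \<in> {1..n}" using V_subset[of Nc] i Nc_ge by auto
  then have "\<bar>x (Ordinary i) - A\<bar> \<le> leader_dist n A x"
    unfolding leader_dist_def by (intro Max_ge) auto
  ultimately show ?thesis using leader_far eps by linarith
qed

text \<open>The step that reaches the leader may leave the tracked states, where the ceiling
  \<open>A\<close> is no longer available; its increment is at most \<open>\<delta>\<close>, which
  accounts for the extra \<open>\<delta>\<close> in the bound. Later terms vanish.\<close>

lemma drift_sum_le:
  assumes init: "clique 1 (X 0) (xs 1)"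
    and step: "\<And>t. hk_step n \<epsilon> (e (Suc t)) (X t) (X (Suc t))"
    and e: "\<And>t. \<bar>e (Suc t)\<bar> \<le> \<delta>"
  shows "(\<Sum>t<N. if \<forall>s\<le>t. \<not> leader_dist n A (X s) \<le> \<epsilon>
    then e (Suc t) / real (card (peers n \<epsilon> (X t) 1)) else 0) \<le> A - xs 1 + \<delta>"
proof -
  define c where "c t \<longleftrightarrow> (\<forall>s\<le>t. \<not> leader_dist n A (X s) \<le> \<epsilon>)" for t
  define w where "w t = e (Suc t) / real (card (peers n \<epsilon> (X t) 1))" for t
  define S where "S N = (\<Sum>t<N. if c t then w t else 0)" for N
  have w: "w t \<le> \<delta>" for t
  proof -
    define m where "m = real (card (peers n \<epsilon> (X t) 1))"
    \<comment> \<open>The case \<open>m = 0\<close> is harmless because division by zero yields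
      0.\<close>
    have "m = 0 \<or> 1 \<le> m" unfolding m_def by (cases "card (peers n \<epsilon> (X t) 1)") auto
    moreover have "w t \<le> \<delta> / m"
      unfolding w_def m_def[symmetric] using e[of t] by (intro divide_right_mono) (auto simp: m_def)
    moreover have "\<delta> / m \<le> \<delta> / 1" if "1 \<le> m" using that delta_pos by (intro divide_left_mono) auto
    ultimately show ?thesis using delta_pos by (cases "m = 0") auto
  qed
  have "(\<exists>\<phi>. tracked (X N) \<phi> \<and> xs 1 + S N \<le> \<phi>) \<or> (\<not> c N \<and> S N \<le> A - xs 1 + \<delta>)"
  proof (induction N)
    case 0
    then show ?case using init by (auto simp: S_def tracked_def)
  next
    case (Suc N)
    have SS: "S (Suc N) = S N + (if c N then w N else 0)" by (simp add: S_def)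
    have cS: "\<not> c (Suc N)" if "\<not> c N" using that by (auto simp: c_def le_Suc_eq)
    from Suc show ?case
    proof (elim disjE exE conjE)
      fix \<phi> assume t: "tracked (X N) \<phi>" and le: "xs 1 + S N \<le> \<phi>"
      note \<phi>A = tracked_le[OF t]
      show ?thesis
      proof (cases "c N")
        case True
        from tracked_step[OF t step e] show ?thesis
        proof (elim disjE exE conjE)
          assume "leader_dist n A (X (Suc N)) \<le> \<epsilon>"
          then have "\<not> c (Suc N)" by (auto simp: c_def)
          moreover have "S (Suc N) \<le> A - xs 1 + \<delta>" using SS True le \<phi>A w[of N] by simp
          ultimately show ?thesis by blast
        next
          fix \<phi>' assume "\<phi> + e (Suc N) / real (card (peers n \<epsilon> (X N) 1)) \<le> \<phi>'" "tracked (X (Suc N)) \<phi>'"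
          then show ?thesis using SS True le by (auto simp: w_def)
        qed
      next
        case False
        then show ?thesis using SS cS le \<phi>A delta_pos by simp
      qed
    next
      assume "\<not> c N" "S N \<le> A - xs 1 + \<delta>"
      then show ?thesis using SS cS by simp
    qed
  qed
  then have "S N \<le> A - xs 1 + \<delta>"
    using tracked_le delta_pos by fastforce
  then show ?thesis unfolding S_def w_def c_def .
qed

text \<open>Under \<open>low\<close> agent 1 never rises above \<open>xs 1\<close>, hence never
  hears the second cluster, and the mean of the first cluster is the noise walk itself.\<close>

lemma first_cluster_walk:
  assumes init: "clique 1 (X 0) (xs 1)"
    and step: "\<And>t. hk_step n \<epsilon> (e (Suc t)) (X t) (X (Suc t))"
    and e: "\<And>t. \<bar>e (Suc t)\<bar> \<le> \<delta>"
    and low: "\<And>t. t < N \<Longrightarrow> (\<Sum>s=1..t. e s) / real (card (grp 1)) + e (Suc t) \<le> 0"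
  shows "clique 1 (X N) (xs 1 + (\<Sum>s=1..N. e s) / real (card (grp 1)))"
  using low
proof (induction N)
  case 0
  then show ?case using init by simp
next
  case (Suc N)
  then have c: "clique 1 (X N) (xs 1 + (\<Sum>s=1..N. e s) / real (card (grp 1)))" by simp
  have "xs 1 < nxt 1 - \<epsilon>" using gap[of 1 2] Nc_ge by (simp add: nxt_def numeral_2_eq_2)
  then have "xs 1 + (\<Sum>s=1..N. e s) / real (card (grp 1)) + e (Suc N) < nxt 1 - \<epsilon>"
    using Suc.prems[of N] by simp
  from clique_step_stay[OF c step e this] show ?case
    by (simp add: add_divide_distrib add.assoc)
qed

end
subsection \<open>The noise\<close>

text \<open>The trajectory as a function of the noise sequence alone: adaptedness becomes invariance
  under \<open>restrict e {1..t}\<close>, and measurability can be checked on the product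
  space.\<close>

primrec hk_run ::
  "nat \<Rightarrow> real \<Rightarrow> (agent \<Rightarrow> real) \<Rightarrow> (nat \<Rightarrow> real) \<Rightarrow> nat \<Rightarrow> agent \<Rightarrow> real" where
  "hk_run n \<epsilon> x e 0 = x"
| "hk_run n \<epsilon> x e (Suc t) = (\<lambda>a. case a of Leader \<Rightarrow> x Leader
     | Ordinary i \<Rightarrow> hk_mean n \<epsilon> (hk_run n \<epsilon> x e t) i + (if i = 1 then e (Suc t) else 0))"

lemma hk_run_Leader: "hk_run n \<epsilon> x e t Leader = x Leader"
  by (cases t) auto

lemma hk_step_run: "hk_step n \<epsilon> (e (Suc t)) (hk_run n \<epsilon> x e t) (hk_run n \<epsilon> x e (Suc t))"
  by (simp add: hk_step_def hk_run_Leader)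

lemma hk_run_cong:
  "(\<And>s. 1 \<le> s \<Longrightarrow> s \<le> t \<Longrightarrow> e s = e' s) \<Longrightarrow> hk_run n \<epsilon> x e t = hk_run n \<epsilon> x e' t"
proof (induction t)
  case (Suc t)
  then have "hk_run n \<epsilon> x e t = hk_run n \<epsilon> x e' t" "e (Suc t) = e' (Suc t)" by auto
  then show ?case by (simp only: hk_run.simps)
qed simp

lemma hk_mean_cong:
  assumes "\<And>a. a \<in> agents n \<Longrightarrow> x a = x' a" "i \<in> {1..n}"
  shows "hk_mean n \<epsilon> x i = hk_mean n \<epsilon> x' i"
proof -
  have "Ordinary i \<in> agents n" using assms(2) by (simp add: agents_def)
  then have "neighbors n \<epsilon> x i = neighbors n \<epsilon> x' i"
    using assms(1) unfolding neighbors_def by auto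
  moreover have "(\<Sum>j\<in>neighbors n \<epsilon> x' i. x j) = (\<Sum>j\<in>neighbors n \<epsilon> x' i. x' j)"
    using assms(1) by (intro sum.cong) (auto simp: neighbors_def)
  ultimately show ?thesis by (simp add: hk_mean_def)
qed

lemma leader_dist_cong:
  assumes "\<And>a. a \<in> agents n \<Longrightarrow> x a = x' a"
  shows "leader_dist n A x = leader_dist n A x'"
proof -
  have "(\<lambda>i. \<bar>x (Ordinary i) - A\<bar>) ` {1..n} = (\<lambda>i. \<bar>x' (Ordinary i) - A\<bar>) ` {1..n}"
    using assms by (intro image_cong) (auto simp: agents_def)
  then show ?thesis by (simp only: leader_dist_def)
qed

lemma finite_agents [simp]: "finite (agents n)"
  by (simp add: agents_def)

text \<open>Sums over the random set of neighbors are rewritten over a fixed finite set, which makes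
  measurability immediate.\<close>

lemma hk_mean_eq:
  "hk_mean n \<epsilon> x i = 1 / (\<Sum>a\<in>agents n. if \<bar>x a - x (Ordinary i)\<bar> \<le> \<epsilon> then 1 else 0) *
    (\<Sum>a\<in>agents n. if \<bar>x a - x (Ordinary i)\<bar> \<le> \<epsilon> then x a else 0)"
proof -
  have *: "(\<Sum>a\<in>agents n. if \<bar>x a - x (Ordinary i)\<bar> \<le> \<epsilon> then f a else 0) =
      (\<Sum>a\<in>neighbors n \<epsilon> x i. f a)" for f :: "agent \<Rightarrow> real"
    unfolding neighbors_def by (simp add: sum.inter_filter)
  show ?thesis unfolding * by (simp add: hk_mean_def)
qed

lemma card_peers_eq:
  "real (card (peers n \<epsilon> x i)) =
    (\<Sum>j\<in>{1..n}. if \<bar>x (Ordinary j) - x (Ordinary i)\<bar> \<le> \<epsilon> then 1 else 0)"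
proof -
  have "real (card (peers n \<epsilon> x i)) = (\<Sum>j\<in>peers n \<epsilon> x i. 1)" by simp
  also have "\<dots> = (\<Sum>j\<in>{1..n}. if \<bar>x (Ordinary j) - x (Ordinary i)\<bar> \<le> \<epsilon> then 1 else 0)"
    unfolding peers_def by (rule sum.inter_filter) simp
  finally show ?thesis .
qed

lemma measurable_hk_mean:
  assumes [measurable]: "\<And>a. (\<lambda>\<omega>. X \<omega> a) \<in> borel_measurable M"
  shows "(\<lambda>\<omega>. hk_mean n \<epsilon> (X \<omega>) i) \<in> borel_measurable M"
  unfolding hk_mean_eq by measurable

lemma measurable_hk_run:
  assumes "\<And>s. 1 \<le> s \<Longrightarrow> s \<le> t \<Longrightarrow> (\<lambda>\<omega>. e \<omega> s) \<in> borel_measurable M"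
  shows "(\<lambda>\<omega>. hk_run n \<epsilon> x (e \<omega>) t a) \<in> borel_measurable M"
  using assms
proof (induction t arbitrary: a)
  case 0
  then show ?case by simp
next
  case (Suc t)
  have [measurable]: "(\<lambda>\<omega>. hk_mean n \<epsilon> (hk_run n \<epsilon> x (e \<omega>) t) i) \<in> borel_measurable M" for i
    using Suc by (intro measurable_hk_mean) auto
  have [measurable]: "(\<lambda>\<omega>. e \<omega> (Suc t)) \<in> borel_measurable M"
    using Suc.prems by simp
  show ?case by (cases a) auto
qed

lemma measurable_card_peers:
  assumes [measurable]: "\<And>a. (\<lambda>\<omega>. X \<omega> a) \<in> borel_measurable M"
  shows "(\<lambda>\<omega>. real (card (peers n \<epsilon> (X \<omega>) i))) \<in> borel_measurable M"
  unfolding card_peers_eq by measurable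

lemma measurable_leader_dist:
  assumes [measurable]: "\<And>a. (\<lambda>\<omega>. X \<omega> a) \<in> borel_measurable M"
  shows "(\<lambda>\<omega>. leader_dist n A (X \<omega>)) \<in> borel_measurable M"
  unfolding leader_dist_def by measurable

text \<open>Tail-sum form of the hitting time: it counts the times before the first hit, and both
  sides are infinite if there is none. This form can be integrated term by term.\<close>

lemma leader_time_eq_suminf:
  "leader_time n \<epsilon> A X = (\<Sum>t. if \<forall>s\<le>t. \<not> leader_dist n A (X s) \<le> \<epsilon> then 1 else 0)"
  (is "_ = (\<Sum>t. ?f t)")
proof (cases "\<exists>t. leader_dist n A (X t) \<le> \<epsilon>")
  case False
  then have "leader_time n \<epsilon> A X = top" by (simp add: leader_time_def)
  moreover have "(\<Sum>t. ?f t) = (\<Sum>t. ennreal 1)" using False by (intro suminf_cong) auto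
  moreover have "(\<Sum>t. ennreal 1) = top"
    using summable_suminf_not_top[of "\<lambda>_. 1"] summable_const_iff[of "1::real"] by auto
  ultimately show ?thesis by simp
next
  case True
  define T where "T = (LEAST t. leader_dist n A (X t) \<le> \<epsilon>)"
  have T: "leader_dist n A (X T) \<le> \<epsilon>" "\<And>t. leader_dist n A (X t) \<le> \<epsilon> \<Longrightarrow> T \<le> t"
    using True LeastI_ex[of "\<lambda>t. leader_dist n A (X t) \<le> \<epsilon>"] Least_le
    unfolding T_def by auto
  have "leader_time n \<epsilon> A X = of_nat T"
    unfolding leader_time_def
    by (intro antisym INF_lower INF_greatest) (use T in auto)
  moreover have "(\<Sum>t. ?f t) = (\<Sum>t<T. ?f t)"
    by (rule suminf_finite) (use T(1) in \<open>auto simp: not_less\<close>)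
  moreover have "(\<Sum>t<T. ?f t) = (\<Sum>t<T. 1)"
    using T(2) by (intro sum.cong) (auto simp: not_le[symmetric] dest!: T(2))
  ultimately show ?thesis by simp
qed

section \<open>Independence of past and next noise; the uniform law\<close>

context prob_space
begin

text \<open>Independence is available for restricted families of coordinates. The assumption
  \<open>cong\<close> says that \<open>g\<close> depends on the first \<open>t\<close> of them only,
  and carries the result over to the unrestricted noise path.\<close>

lemma expectation_past_times_next:
  fixes \<xi> :: "nat \<Rightarrow> 'a \<Rightarrow> real"
  assumes ind: "indep_vars (\<lambda>_. borel) \<xi> {1..}"
    and g: "g \<in> borel_measurable (PiM {1..t} (\<lambda>_. borel))"
    and cong: "\<And>e. g (restrict e {1..t}) = g e"
    and bound: "\<And>e. \<bar>g e\<bar> \<le> B"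
    and int: "integrable M (\<xi> (Suc t))"
  shows "integrable M (\<lambda>\<omega>. g (\<lambda>s. \<xi> s \<omega>))"
    and "integrable M (\<lambda>\<omega>. g (\<lambda>s. \<xi> s \<omega>) * \<xi> (Suc t) \<omega>)"
    and "expectation (\<lambda>\<omega>. g (\<lambda>s. \<xi> s \<omega>) * \<xi> (Suc t) \<omega>) =
      expectation (\<lambda>\<omega>. g (\<lambda>s. \<xi> s \<omega>)) * expectation (\<xi> (Suc t))"
proof -
  have rv: "\<xi> s \<in> borel_measurable M" if "1 \<le> s" for s
    using ind that by (auto simp: indep_vars_def)
  have "indep_var (PiM {1..t} (\<lambda>_. borel)) (\<lambda>\<omega>. restrict (\<lambda>i. \<xi> i \<omega>) {1..t})
      (PiM {Suc t} (\<lambda>_. borel)) (\<lambda>\<omega>. restrict (\<lambda>i. \<xi> i \<omega>) {Suc t})"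
    using ind by (rule indep_var_restrict) auto
  then have "indep_var borel (g \<circ> (\<lambda>\<omega>. restrict (\<lambda>i. \<xi> i \<omega>) {1..t}))
      borel ((\<lambda>f. f (Suc t)) \<circ> (\<lambda>\<omega>. restrict (\<lambda>i. \<xi> i \<omega>) {Suc t}))"
    by (rule indep_var_compose) (use g in measurable)
  then have iv: "indep_var borel (\<lambda>\<omega>. g (\<lambda>s. \<xi> s \<omega>)) borel (\<xi> (Suc t))"
    by (simp add: comp_def cong[simplified])
  have "(\<lambda>\<omega>. restrict (\<lambda>i. \<xi> i \<omega>) {1..t}) \<in> measurable M (PiM {1..t} (\<lambda>_. borel))"
    using rv by (intro measurable_restrict) auto
  from measurable_compose[OF this g] have "(\<lambda>\<omega>. g (\<lambda>s. \<xi> s \<omega>)) \<in> borel_measurable M"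
    by (simp add: cong[simplified])
  then show ig: "integrable M (\<lambda>\<omega>. g (\<lambda>s. \<xi> s \<omega>))"
    by (intro integrable_const_bound[of _ B]) (use bound in auto)
  show "integrable M (\<lambda>\<omega>. g (\<lambda>s. \<xi> s \<omega>) * \<xi> (Suc t) \<omega>)"
    by (rule indep_var_integrable[OF iv ig int])
  show "expectation (\<lambda>\<omega>. g (\<lambda>s. \<xi> s \<omega>) * \<xi> (Suc t) \<omega>) =
      expectation (\<lambda>\<omega>. g (\<lambda>s. \<xi> s \<omega>)) * expectation (\<xi> (Suc t))"
    by (rule indep_var_lebesgue_integral[OF iv ig int])
qed

lemma
  fixes a b :: real
  assumes X [measurable]: "X \<in> borel_measurable M" and ab: "a < b"
    and D: "distr M borel X = uniform_measure lborel {a..b}"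
  shows uniform_AE_bounds: "AE \<omega> in M. a \<le> X \<omega> \<and> X \<omega> \<le> b"
    and uniform_expectation: "expectation X = (a + b) / 2"
    and uniform_prob_le: "a \<le> c \<Longrightarrow> c \<le> b \<Longrightarrow> prob (X -` {..c} \<inter> space M) = (c - a) / (b - a)"
proof -
  have dist: "distributed M lborel X (\<lambda>x. indicator {a..b} x / measure lborel {a..b})"
    unfolding distributed_def
  proof (intro conjI)
    have "distr M lborel X = distr M borel X" by (intro distr_cong) auto
    also have "\<dots> = density lborel (\<lambda>x. indicator {a..b} x / emeasure lborel {a..b})"
      using D by (simp add: uniform_measure_def)
    also have "\<dots> = density lborel (\<lambda>x. ennreal (indicator {a..b} x / measure lborel {a..b}))"
      using ab by (intro density_cong) (auto simp: indicator_def divide_ennreal simp flip: ennreal_1)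
    finally show "distr M lborel X = density lborel (\<lambda>x. ennreal (indicator {a..b} x / measure lborel {a..b}))" .
  qed auto
  show "expectation X = (a + b) / 2" by (rule uniform_distributed_expectation[OF dist])
  show "prob (X -` {..c} \<inter> space M) = (c - a) / (b - a)" if "a \<le> c" "c \<le> b"
    using uniform_distributed_measure[OF dist that]
    by (simp add: vimage_def Int_def conj_commute)
  have "AE x in distr M borel X. a \<le> x \<and> x \<le> b"
    unfolding D by (intro AE_uniform_measureI) auto
  then show "AE \<omega> in M. a \<le> X \<omega> \<and> X \<omega> \<le> b"
    by (rule AE_distrD[rotated]) simp
qed

end

section \<open>The expected time as a series, and the case of positive mean\<close>

locale noisy_divisive_run = prob_space M + divisive_clusters n Nc \<epsilon> A \<delta> V xs
  for M :: "'a measure" and n Nc :: nat and \<epsilon> A \<delta> :: real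
    and V :: "nat \<Rightarrow> nat set" and xs :: "nat \<Rightarrow> real" +
  fixes \<xi> :: "nat \<Rightarrow> 'a \<Rightarrow> real" and x0 :: "agent \<Rightarrow> real"
  assumes indep: "indep_vars (\<lambda>_. borel) \<xi> {1..}"
    and bounded: "\<And>t. AE \<omega> in M. \<bar>\<xi> (Suc t) \<omega>\<bar> \<le> \<delta>"
    and start: "clique 1 x0 (xs 1)"
begin

abbreviation run :: "(nat \<Rightarrow> real) \<Rightarrow> nat \<Rightarrow> agent \<Rightarrow> real" where
  "run \<equiv> hk_run n \<epsilon> x0"

abbreviation noise :: "'a \<Rightarrow> nat \<Rightarrow> real" where
  "noise \<omega> \<equiv> (\<lambda>s. \<xi> s \<omega>)"

text \<open>The event \<open>T\<^sub>l > t\<close>, phrased for noise sequences so that it can be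
  evaluated on restricted ones.\<close>

definition unreached :: "nat \<Rightarrow> (nat \<Rightarrow> real) \<Rightarrow> bool" where
  "unreached t e \<longleftrightarrow> (\<forall>s\<in>{..t}. \<not> leader_dist n A (run e s) \<le> \<epsilon>)"

lemma noise_measurable: "1 \<le> s \<Longrightarrow> \<xi> s \<in> borel_measurable M"
  using indep by (auto simp: indep_vars_def)

lemma noise_integrable: "integrable M (\<xi> (Suc t))"
  using bounded[of t] noise_measurable by (intro integrable_const_bound[of _ \<delta>]) auto

lemma AE_all_bounded: "AE \<omega> in M. \<forall>t. \<bar>\<xi> (Suc t) \<omega>\<bar> \<le> \<delta>"
  using bounded by (simp add: AE_all_countable)

lemma measurable_unreached:
  assumes e: "\<And>s. 1 \<le> s \<Longrightarrow> s \<le> t \<Longrightarrow> (\<lambda>\<omega>. e \<omega> s) \<in> borel_measurable N"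
  shows "Measurable.pred N (\<lambda>\<omega>. unreached t (e \<omega>))"
  unfolding unreached_def
proof (intro pred_intros_finite pred_intros_logic)
  fix s assume "s \<in> {..t}"
  then have [measurable]: "(\<lambda>\<omega>. leader_dist n A (run (e \<omega>) s)) \<in> borel_measurable N"
    using e by (intro measurable_leader_dist measurable_hk_run) auto
  show "Measurable.pred N (\<lambda>\<omega>. leader_dist n A (run (e \<omega>) s) \<le> \<epsilon>)" by measurable
qed auto

lemma measurable_unreached_noise [measurable]:
  "Measurable.pred M (\<lambda>\<omega>. unreached t (noise \<omega>))"
  using noise_measurable by (intro measurable_unreached) auto

lemma unreached_restrict: "unreached t (restrict e {1..t}) = unreached t e"
proof -
  have "run (restrict e {1..t}) s = run e s" if "s \<le> t" for s
    using that by (intro hk_run_cong) auto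
  then show ?thesis by (auto simp: unreached_def)
qed

lemma expected_leader_time:
  "(\<integral>\<^sup>+\<omega>. leader_time n \<epsilon> A (run (noise \<omega>)) \<partial>M) =
    (\<Sum>t. ennreal (prob {\<omega> \<in> space M. unreached t (noise \<omega>)}))"
proof -
  have "(\<integral>\<^sup>+\<omega>. leader_time n \<epsilon> A (run (noise \<omega>)) \<partial>M) =
      (\<integral>\<^sup>+\<omega>. (\<Sum>t. indicator {\<omega> \<in> space M. unreached t (noise \<omega>)} \<omega>) \<partial>M)"
    unfolding leader_time_eq_suminf
    by (intro nn_integral_cong suminf_cong) (auto simp: unreached_def indicator_def)
  also have "\<dots> = (\<Sum>t. \<integral>\<^sup>+\<omega>. indicator {\<omega> \<in> space M. unreached t (noise \<omega>)} \<omega> \<partial>M)"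
    by (intro nn_integral_suminf) measurable
  also have "\<dots> = (\<Sum>t. ennreal (prob {\<omega> \<in> space M. unreached t (noise \<omega>)}))"
    by (intro suminf_cong) (simp add: emeasure_eq_measure)
  finally show ?thesis .
qed

text \<open>Both \<open>unreached t\<close> and the weight \<open>m\<close> are determined by the
  first \<open>t\<close> noise values, so step \<open>t\<close> contributes \<open>\<mu>\<close>
  times the expectation of \<open>g t\<close>, which is at least \<open>\<mu> / n\<close> times the
  probability of \<open>T\<^sub>l > t\<close>. The pathwise ceiling bounds the partial sums
  uniformly in \<open>N\<close>.\<close>

lemma expected_leader_time_le:
  assumes mu: "\<And>t. expectation (\<xi> (Suc t)) = \<mu>" "\<mu> > 0"
  shows "(\<integral>\<^sup>+\<omega>. leader_time n \<epsilon> A (run (noise \<omega>)) \<partial>M) \<le>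
    ennreal (real n / \<mu> * (A - xs 1 + \<delta>))"
proof -
  define m where "m t e = real (card (peers n \<epsilon> (run e t) 1))" for t e
  define g where "g t e = (if unreached t e then 1 / m t e else 0)" for t e
  define P where "P t = prob {\<omega> \<in> space M. unreached t (noise \<omega>)}" for t
  have m: "1 \<le> m t e" "m t e \<le> real n" for t e
  proof -
    have "1 \<in> peers n \<epsilon> (run e t) 1" using n_ge eps by (auto simp: peers_def)
    then have "0 < card (peers n \<epsilon> (run e t) 1)" by (auto simp: card_gt_0_iff)
    then show "1 \<le> m t e" unfolding m_def by linarith
    have "card (peers n \<epsilon> (run e t) 1) \<le> card {1..n}"
      by (intro card_mono) (auto simp: peers_def)
    then show "m t e \<le> real n" unfolding m_def by simp
  qed
  have gb: "\<bar>g t e\<bar> \<le> 1" for t e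
    using m(1)[of t e] by (auto simp: g_def)
  have gm: "g t \<in> borel_measurable (PiM {1..t} (\<lambda>_. borel))" for t
  proof -
    have e: "(\<lambda>e. e s) \<in> borel_measurable (PiM {1..t} (\<lambda>_. borel :: real measure))"
      if "1 \<le> s" "s \<le> t" for s
      using that by (intro measurable_component_singleton) auto
    have [measurable]: "Measurable.pred (PiM {1..t} (\<lambda>_. borel)) (unreached t)"
      using e by (intro measurable_unreached[where e = "\<lambda>e. e"])
    have [measurable]: "m t \<in> borel_measurable (PiM {1..t} (\<lambda>_. borel))"
      unfolding m_def using e by (intro measurable_card_peers measurable_hk_run)
    show ?thesis unfolding g_def by measurable
  qed
  have gc: "g t (restrict e {1..t}) = g t e" for t e
  proof -
    have "run (restrict e {1..t}) t = run e t" by (intro hk_run_cong) auto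
    then show ?thesis by (simp only: g_def m_def unreached_restrict)
  qed
  note gE = expectation_past_times_next[OF indep gm gc gb noise_integrable]
  have lower: "P t / real n \<le> expectation (\<lambda>\<omega>. g t (noise \<omega>))" for t
  proof -
    have "expectation (\<lambda>\<omega>. indicator {\<omega> \<in> space M. unreached t (noise \<omega>)} \<omega> / real n) \<le>
        expectation (\<lambda>\<omega>. g t (noise \<omega>))"
    proof (intro integral_mono gE(1))
      fix \<omega> assume "\<omega> \<in> space M"
      have "1 / real n \<le> 1 / m t (noise \<omega>)"
        using m[of t "noise \<omega>"] by (intro divide_left_mono) auto
      then show "indicator {\<omega> \<in> space M. unreached t (noise \<omega>)} \<omega> / real n \<le> g t (noise \<omega>)"
        using m(1)[of t "noise \<omega>"] by (auto simp: g_def indicator_def)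
    qed (simp add: emeasure_eq_measure)
    then show ?thesis by (simp add: P_def)
  qed
  have bound: "(\<Sum>t<N. P t) \<le> real n / \<mu> * (A - xs 1 + \<delta>)" for N
  proof -
    have "(\<Sum>t<N. P t) * (\<mu> / real n) = (\<Sum>t<N. P t / real n * \<mu>)"
      by (simp add: sum_distrib_right sum_divide_distrib)
    also have "\<dots> \<le> (\<Sum>t<N. expectation (\<lambda>\<omega>. g t (noise \<omega>)) * \<mu>)"
      using lower mu by (intro sum_mono mult_right_mono) auto
    also have "\<dots> = expectation (\<lambda>\<omega>. \<Sum>t<N. g t (noise \<omega>) * \<xi> (Suc t) \<omega>)"
      using gE mu by (simp add: Bochner_Integration.integral_sum)
    also have "\<dots> \<le> A - xs 1 + \<delta>"
    proof (rule integral_le_const)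
      show "integrable M (\<lambda>\<omega>. \<Sum>t<N. g t (noise \<omega>) * \<xi> (Suc t) \<omega>)"
        using gE(2) by (intro Bochner_Integration.integrable_sum) auto
      show "AE \<omega> in M. (\<Sum>t<N. g t (noise \<omega>) * \<xi> (Suc t) \<omega>) \<le> A - xs 1 + \<delta>"
        using AE_all_bounded
      proof eventually_elim
        fix \<omega> assume e: "\<forall>t. \<bar>\<xi> (Suc t) \<omega>\<bar> \<le> \<delta>"
        have "(\<Sum>t<N. g t (noise \<omega>) * \<xi> (Suc t) \<omega>) =
            (\<Sum>t<N. if \<forall>s\<le>t. \<not> leader_dist n A (run (noise \<omega>) s) \<le> \<epsilon>
              then noise \<omega> (Suc t) / real (card (peers n \<epsilon> (run (noise \<omega>) t) 1)) else 0)"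
          by (intro sum.cong refl) (auto simp: g_def m_def unreached_def)
        also have "\<dots> \<le> A - xs 1 + \<delta>"
          using e start by (intro drift_sum_le hk_step_run) auto
        finally show "(\<Sum>t<N. g t (noise \<omega>) * \<xi> (Suc t) \<omega>) \<le> A - xs 1 + \<delta>" .
      qed
    qed
    finally show ?thesis using mu n_ge by (simp add: field_simps)
  qed
  have "(\<Sum>t. ennreal (P t)) \<le> ennreal (real n / \<mu> * (A - xs 1 + \<delta>))"
  proof (rule suminf_le_const)
    fix N
    have "(\<Sum>t<N. ennreal (P t)) = ennreal (\<Sum>t<N. P t)"
      by (simp add: P_def)
    then show "(\<Sum>t<N. ennreal (P t)) \<le> ennreal (real n / \<mu> * (A - xs 1 + \<delta>))"
      using bound by (simp add: ennreal_leI)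
  qed simp
  then show ?thesis by (simp add: expected_leader_time P_def)
qed

section \<open>The case of zero mean\<close>

text \<open>After \<open>2 * n + 2\<close> steps of at most \<open>- \<delta> / 2\<close>, the sum of the noise is \<open>\<delta>\<close> below
  the threshold \<open>- n * \<delta>\<close> under which agent 1 cannot reach the second cluster in one step.\<close>

definition descent :: "(nat \<Rightarrow> real) \<Rightarrow> bool" where
  "descent e \<longleftrightarrow> (\<forall>s\<in>{1..2 * n + 2}. e s \<le> - \<delta> / 2)"

definition stays_low :: "nat \<Rightarrow> (nat \<Rightarrow> real) \<Rightarrow> bool" where
  "stays_low t e \<longleftrightarrow> descent e \<and> (\<forall>s\<in>{2 * n + 2..t}. (\<Sum>r=1..s. e r) \<le> - (real n * \<delta>))"

lemma measurable_descent:
  assumes "\<And>s. 1 \<le> s \<Longrightarrow> s \<le> 2 * n + 2 \<Longrightarrow> (\<lambda>\<omega>. e \<omega> s) \<in> borel_measurable N"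
  shows "Measurable.pred N (\<lambda>\<omega>. descent (e \<omega>))"
  unfolding descent_def
proof (intro pred_intros_finite)
  fix s assume "s \<in> {1..2 * n + 2}"
  then have [measurable]: "(\<lambda>\<omega>. e \<omega> s) \<in> borel_measurable N" using assms by auto
  show "Measurable.pred N (\<lambda>\<omega>. e \<omega> s \<le> - \<delta> / 2)" by measurable
qed auto

lemma measurable_stays_low:
  assumes "2 * n + 2 \<le> t"
    and e: "\<And>s. 1 \<le> s \<Longrightarrow> s \<le> t \<Longrightarrow> (\<lambda>\<omega>. e \<omega> s) \<in> borel_measurable N"
  shows "Measurable.pred N (\<lambda>\<omega>. stays_low t (e \<omega>))"
  unfolding stays_low_def
proof (intro pred_intros_finite pred_intros_logic measurable_descent)
  fix s assume "s \<in> {2 * n + 2..t}"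
  then have [measurable]: "(\<lambda>\<omega>. \<Sum>r=1..s. e \<omega> r) \<in> borel_measurable N"
    using e by (intro borel_measurable_sum) auto
  show "Measurable.pred N (\<lambda>\<omega>. (\<Sum>r=1..s. e \<omega> r) \<le> - (real n * \<delta>))" by measurable
qed (use assms in auto)

lemma descent_sum:
  assumes "descent e" "t \<le> 2 * n + 2"
  shows "(\<Sum>s=1..t. e s) \<le> - (real t * (\<delta> / 2))"
proof -
  have "(\<Sum>s=1..t. e s) \<le> (\<Sum>s=1..t. - \<delta> / 2)"
    using assms by (intro sum_mono) (auto simp: descent_def)
  then show ?thesis by simp
qed

text \<open>During the descent both the walk and the next noise value are nonpositive. Afterwards
  the walk divided by the cluster size \<open>p \<le> n\<close> is at most
  \<open>- \<delta>\<close>, which cancels any single noise value. So the first cluster remains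
  isolated and the last one never moves.\<close>

lemma stays_low_unreached:
  assumes e: "\<And>t. \<bar>e (Suc t)\<bar> \<le> \<delta>" and B: "stays_low N e"
  shows "unreached N e"
  unfolding unreached_def
proof
  fix s assume s: "s \<in> {..N}"
  define p where "p = real (card (grp 1))"
  have p: "1 \<le> p" "p \<le> real n"
    using card_grp_pos[of 1] card_grp_le[of 1] Nc_ge unfolding p_def by linarith+
  have "clique 1 (run e s) (xs 1 + (\<Sum>r=1..s. e r) / real (card (grp 1)))"
  proof (rule first_cluster_walk)
    fix t assume t: "t < s"
    define S where "S = (\<Sum>r=1..t. e r)"
    have "S / p + e (Suc t) \<le> 0"
    proof (cases "t < 2 * n + 2")
      case True
      then have "e (Suc t) \<le> - \<delta> / 2" using B by (auto simp: stays_low_def descent_def)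
      moreover have "S \<le> - (real t * (\<delta> / 2))"
        unfolding S_def using B True by (intro descent_sum) (auto simp: stays_low_def)
      moreover have "0 \<le> real t * (\<delta> / 2)" using delta_pos by simp
      ultimately show ?thesis
        using divide_nonpos_pos[of S p] p delta_pos by linarith
    next
      case False
      then have "S \<le> - (real n * \<delta>)" using B t s by (auto simp: stays_low_def S_def)
      also have "\<dots> \<le> - \<delta> * p" using p delta_pos by (simp add: mult.commute)
      finally have "S / p \<le> - \<delta>" using p by (simp add: pos_divide_le_eq)
      then show ?thesis using e[of t] by simp
    qed
    then show "(\<Sum>s=1..t. e s) / real (card (grp 1)) + e (Suc t) \<le> 0" by (simp only: S_def p_def)
  qed (use start e hk_step_run in auto)
  then show "\<not> leader_dist n A (run e s) \<le> \<epsilon>" using Nc_ge by (intro clique_far) auto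
qed

text \<open>On the descent, the walk stopped when it leaves the low region has gained at least
  \<open>\<delta>\<close>; while it has not stopped, it has lost at most \<open>\<delta>\<close> per step.\<close>

lemma stays_low_stopped_sum:
  assumes e: "\<And>t. \<bar>e (Suc t)\<bar> \<le> \<delta>" and N: "2 * n + 2 \<le> N"
  shows "\<delta> * of_bool (descent e) - \<delta> * (1 + real N) * of_bool (stays_low N e) \<le>
    (\<Sum>t=2 * n + 2..<N. of_bool (stays_low t e) * e (Suc t))"
proof (cases "descent e")
  case False
  then show ?thesis by (simp add: stays_low_def)
next
  case True
  define K where "K = 2 * n + 2"
  define S where "S t = (\<Sum>s=1..t. e s)" for t
  have SK: "S K \<le> - (real n * \<delta>) - \<delta>"
    using descent_sum[OF True, of K] by (simp add: K_def S_def algebra_simps)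
  have BK: "stays_low K e"
    using True SK delta_pos by (auto simp: stays_low_def K_def S_def)
  \<comment> \<open>While the walk is low the sum telescopes. The term of the exit step is still
    included, as its factor refers to the time before; it lifts the walk from at most
    \<open>- n * \<delta> - \<delta>\<close> at time \<open>K\<close> to above
    \<open>- n * \<delta>\<close>. All later terms vanish.\<close>
  have "(stays_low N e \<longrightarrow> (\<Sum>t=K..<N. of_bool (stays_low t e) * e (Suc t)) = S N - S K) \<and>
    (\<not> stays_low N e \<longrightarrow> \<delta> \<le> (\<Sum>t=K..<N. of_bool (stays_low t e) * e (Suc t)))"
    using N[folded K_def]
  proof (induction N rule: dec_induct)
    case base
    then show ?case using BK by simp
  next
    case (step j)
    have "{2 * n + 2..Suc j} = insert (Suc j) {2 * n + 2..j}"
      using step.hyps by (auto simp: K_def)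
    then have "stays_low (Suc j) e \<longleftrightarrow> stays_low j e \<and> S (Suc j) \<le> - (real n * \<delta>)"
      by (auto simp: stays_low_def S_def simp del: sum.cl_ivl_Suc)
    moreover have "S (Suc j) = S j + e (Suc j)" by (simp add: S_def)
    ultimately show ?case
      using step SK by (cases "stays_low j e") auto
  qed
  \<comment> \<open>The factor \<open>1 + N\<close> in the claim combines this worst loss
    \<open>\<delta> * N\<close> with the \<open>\<delta>\<close> credited to the descent.\<close>
  moreover have "- (\<delta> * real N) \<le> S N - S K"
  proof -
    have "- (\<delta> * real N) = (\<Sum>s=1..N. - \<delta>)" by simp
    also have "\<dots> \<le> S N"
      unfolding S_def
    proof (intro sum_mono)
      fix s assume "s \<in> {1..N}"
      then show "- \<delta> \<le> e s" using e[of "s - 1"] by auto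
    qed
    moreover have "0 \<le> real n * \<delta>" using delta_pos by simp
    ultimately show ?thesis using SK delta_pos by linarith
  qed
  ultimately show ?thesis
    using True by (cases "stays_low N e") (auto simp: algebra_simps K_def)
qed

text \<open>A zero-mean walk that starts low needs an infinite expected time to climb back:
  optional stopping at time \<open>N\<close> shows that it stays low until \<open>N\<close> with probability at
  least of order \<open>1 / N\<close>.\<close>

lemma expected_leader_time_infinite:
  assumes mu: "\<And>t. expectation (\<xi> (Suc t)) = 0"
    and left: "\<And>t. prob (\<xi> (Suc t) -` {..- \<delta> / 2} \<inter> space M) > 0"
  shows "(\<integral>\<^sup>+\<omega>. leader_time n \<epsilon> A (run (noise \<omega>)) \<partial>M) = \<infinity>"
proof -
  define K where "K = 2 * n + 2"
  define PE where "PE = prob {\<omega> \<in> space M. descent (noise \<omega>)}"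
  define P where "P t = prob {\<omega> \<in> space M. stays_low t (noise \<omega>)}" for t
  have mB: "{\<omega> \<in> space M. stays_low t (noise \<omega>)} \<in> sets M" if "K \<le> t" for t
    using that noise_measurable measurable_stays_low[of t noise M] by (auto simp: K_def pred_def)
  have mE: "{\<omega> \<in> space M. descent (noise \<omega>)} \<in> sets M"
    using noise_measurable measurable_descent[of noise M] by (auto simp: pred_def)
  have PE: "PE > 0"
  proof -
    have "PE = prob (\<Inter>s\<in>{1..K}. \<xi> s -` {..- \<delta> / 2} \<inter> space M)"
      unfolding PE_def descent_def K_def by (intro arg_cong[of _ _ prob]) auto
    also have "\<dots> = (\<Prod>s\<in>{1..K}. prob (\<xi> s -` {..- \<delta> / 2} \<inter> space M))"
      using indep by (rule indep_varsD) (auto simp: K_def)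
    also have "\<dots> > 0"
    proof (intro prod_pos)
      fix s assume "s \<in> {1..K}"
      then show "0 < prob (\<xi> s -` {..- \<delta> / 2} \<inter> space M)" using left[of "s - 1"] by auto
    qed
    finally show ?thesis .
  qed
  have harmonic: "PE / (1 + real N) \<le> P N" if N: "K \<le> N" for N
  proof -
    have gB: "(\<lambda>e. of_bool (stays_low t e) :: real) \<in> borel_measurable (PiM {1..t} (\<lambda>_. borel))" if "K \<le> t" for t
    proof -
      have [measurable]: "Measurable.pred (PiM {1..t} (\<lambda>_. borel)) (stays_low t)"
        using that unfolding K_def
        by (intro measurable_stays_low[where e = "\<lambda>e. e"] measurable_component_singleton) auto
      show ?thesis by measurable
    qed
    have cB: "(of_bool (stays_low t (restrict e {1..t})) :: real) = of_bool (stays_low t e)" if "K \<le> t" for t e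
    proof -
      have "(\<Sum>r=1..s. restrict e {1..t} r) = (\<Sum>r=1..s. e r)" if "s \<le> t" for s
        using that by (intro sum.cong) auto
      then have "stays_low t (restrict e {1..t}) = stays_low t e"
        using that by (auto simp: stays_low_def descent_def K_def)
      then show ?thesis by simp
    qed
    \<comment> \<open>Whether the walk is still low at time \<open>t\<close> is decided by the first
      \<open>t\<close> noise values, so every term of the stopped sum has mean zero.\<close>
    have BE: "integrable M (\<lambda>\<omega>. of_bool (stays_low t (noise \<omega>)) * \<xi> (Suc t) \<omega>)"
        "expectation (\<lambda>\<omega>. of_bool (stays_low t (noise \<omega>)) * \<xi> (Suc t) \<omega>) = 0"
      if "K \<le> t" for t
      using expectation_past_times_next[OF indep gB cB _ noise_integrable, of t 1] that mu by auto
    have "\<delta> * PE - \<delta> * (1 + real N) * P N =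
        expectation (\<lambda>\<omega>. \<delta> * indicator {\<omega> \<in> space M. descent (noise \<omega>)} \<omega> -
          \<delta> * (1 + real N) * indicator {\<omega> \<in> space M. stays_low N (noise \<omega>)} \<omega>)"
      using N mE mB by (simp add: PE_def P_def emeasure_eq_measure)
    also have "\<dots> \<le> expectation (\<lambda>\<omega>. \<Sum>t=K..<N. of_bool (stays_low t (noise \<omega>)) * \<xi> (Suc t) \<omega>)"
    proof (rule integral_mono_AE)
      show "AE \<omega> in M. \<delta> * indicator {\<omega> \<in> space M. descent (noise \<omega>)} \<omega> -
          \<delta> * (1 + real N) * indicator {\<omega> \<in> space M. stays_low N (noise \<omega>)} \<omega>
          \<le> (\<Sum>t=K..<N. of_bool (stays_low t (noise \<omega>)) * \<xi> (Suc t) \<omega>)"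
        using AE_all_bounded AE_space
      proof eventually_elim
        fix \<omega> assume "\<forall>t. \<bar>\<xi> (Suc t) \<omega>\<bar> \<le> \<delta>" "\<omega> \<in> space M"
        then show "\<delta> * indicator {\<omega> \<in> space M. descent (noise \<omega>)} \<omega> -
          \<delta> * (1 + real N) * indicator {\<omega> \<in> space M. stays_low N (noise \<omega>)} \<omega>
          \<le> (\<Sum>t=K..<N. of_bool (stays_low t (noise \<omega>)) * \<xi> (Suc t) \<omega>)"
          using stays_low_stopped_sum[OF _ N[unfolded K_def], of "noise \<omega>"] by (simp add: indicator_def of_bool_def K_def)
      qed
    next
      show "integrable M (\<lambda>\<omega>. \<Sum>t=K..<N. of_bool (stays_low t (noise \<omega>)) * \<xi> (Suc t) \<omega>)"
        using BE by (intro Bochner_Integration.integrable_sum) auto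
    qed (use N mE mB in \<open>auto simp: emeasure_eq_measure\<close>)
    also have "\<dots> = 0" using BE by (subst Bochner_Integration.integral_sum) auto
    finally have "PE * \<delta> \<le> (1 + real N) * P N * \<delta>" by (simp add: algebra_simps)
    then have "PE \<le> (1 + real N) * P N" using delta_pos by simp
    then show ?thesis by (simp add: pos_divide_le_eq mult.commute)
  qed
  show ?thesis
  proof (rule ccontr)
    assume "\<not> ?thesis"
    then have sm: "summable (\<lambda>t. prob {\<omega> \<in> space M. unreached t (noise \<omega>)})"
      by (intro summable_suminf_not_top) (auto simp: expected_leader_time)
    \<comment> \<open>A finite expectation would make the tail probabilities summable, yet from
      \<open>K\<close> on they dominate a multiple of the harmonic series.\<close>
    have "summable (\<lambda>t. PE / (1 + real t))"
    proof (rule summable_comparison_test'[OF sm])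
      fix t assume t: "K \<le> t"
      have "PE / (1 + real t) \<le> P t" by (rule harmonic[OF t])
      also have "\<dots> \<le> prob {\<omega> \<in> space M. unreached t (noise \<omega>)}"
        unfolding P_def
      proof (rule finite_measure_mono_AE)
        show "AE \<omega> in M. \<omega> \<in> {\<omega> \<in> space M. stays_low t (noise \<omega>)} \<longrightarrow>
            \<omega> \<in> {\<omega> \<in> space M. unreached t (noise \<omega>)}"
          using AE_all_bounded by eventually_elim (use stays_low_unreached in auto)
      qed measurable
      finally show "norm (PE / (1 + real t)) \<le> prob {\<omega> \<in> space M. unreached t (noise \<omega>)}"
        using PE by simp
    qed
    then have "summable (\<lambda>t. inverse PE * (PE / (1 + real t)))" by (rule summable_mult)
    then have "summable (\<lambda>t. inverse (of_nat (Suc t)) :: real)"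
      using PE by (simp add: field_simps)
    then show False using not_summable_harmonic summable_Suc_iff by blast
  qed
qed

end

section \<open>Transfer to the given trajectories\<close>

theorem theorem5p6:
  fixes M :: "'a measure"
    and n Nc :: nat
    and \<epsilon> A \<delta>1 \<delta>2 :: real
    and V :: "nat \<Rightarrow> nat set"
    and xs :: "nat \<Rightarrow> real"
    and \<xi> :: "nat \<Rightarrow> 'a \<Rightarrow> real"
    and x :: "'a \<Rightarrow> nat \<Rightarrow> agent \<Rightarrow> real"
  assumes prob: "prob_space M"
    and eps: "\<epsilon> > 0"
    and delta: "0 \<le> \<delta>1" "\<delta>1 \<le> \<delta>2" "0 < \<delta>2" "\<delta>2 \<le> \<epsilon> / (2 * real n)"
    and noise_indep: "prob_space.indep_vars M (\<lambda>_. borel) \<xi> {1..}"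
    and noise_unif: "\<And>t. t \<ge> 1 \<Longrightarrow> distr M borel (\<xi> t) = uniform_measure lborel {-\<delta>1..\<delta>2}"
    and initial: "\<And>\<omega>. \<omega> \<in> space M \<Longrightarrow> divisive_initial n \<epsilon> Nc V xs (x \<omega> 0)"
    and agent1: "1 \<in> V 1"
    and leader_far: "A > xs Nc + \<epsilon>"
    and leader: "\<And>\<omega> t. \<omega> \<in> space M \<Longrightarrow> x \<omega> t Leader = A"
    and dynamics: "\<And>\<omega> t i. \<omega> \<in> space M \<Longrightarrow> i \<in> {1..n} \<Longrightarrow>
      x \<omega> (Suc t) (Ordinary i) =
        (1 / real (card (neighbors n \<epsilon> (x \<omega> t) i))) * (\<Sum>j\<in>neighbors n \<epsilon> (x \<omega> t) i. x \<omega> t j)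
        + (if i = 1 then \<xi> (Suc t) \<omega> else 0)"
  shows "(\<delta>1 = \<delta>2 \<longrightarrow> (\<integral>\<^sup>+\<omega>. leader_time n \<epsilon> A (x \<omega>) \<partial>M) = \<infinity>) \<and>
    (\<delta>1 < \<delta>2 \<longrightarrow> (\<integral>\<^sup>+\<omega>. leader_time n \<epsilon> A (x \<omega>) \<partial>M) \<le>
      ennreal (2 * real n / (\<delta>2 - \<delta>1) * (A - xs 1 + \<epsilon> + real Nc * \<delta>2)))"
proof -
  interpret prob_space M by (rule prob)
  \<comment> \<open>On \<open>agents n\<close> the initial state is the same for all outcomes, so
    its value at one outcome serves as a deterministic start.\<close>
  obtain \<omega>0 where w0: "\<omega>0 \<in> space M" using not_empty by blast
  define x0 where "x0 = x \<omega>0 0"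
  have div0: "divisive_initial n \<epsilon> Nc V xs x0" unfolding x0_def by (rule initial[OF w0])
  have rv: "\<xi> (Suc t) \<in> borel_measurable M" for t
    using noise_indep by (auto simp: indep_vars_def)
  have unif: "distr M borel (\<xi> (Suc t)) = uniform_measure lborel {- \<delta>1..\<delta>2}" for t
    by (rule noise_unif) simp
  have ab: "- \<delta>1 < \<delta>2" using delta by simp
  interpret divisive_clusters n Nc \<epsilon> A \<delta>2 V xs
    using div0 eps delta agent1 leader_far
    unfolding divisive_initial_def by unfold_locales auto
  interpret noisy_divisive_run M n Nc \<epsilon> A \<delta>2 V xs \<xi> x0
  proof
    show "indep_vars (\<lambda>_. borel) \<xi> {1..}" by (rule noise_indep)
    show "AE \<omega> in M. \<bar>\<xi> (Suc t) \<omega>\<bar> \<le> \<delta>2" for t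
      using uniform_AE_bounds[OF rv[of t] ab unif[of t]] by eventually_elim (use delta in auto)
    show "clique 1 x0 (xs 1)"
      using clique_initial[OF div0] leader[OF w0] by (simp add: x0_def)
  qed
  \<comment> \<open>The given trajectories are determined only on \<open>agents n\<close>, and
    \<open>leader_dist\<close> sees no other values, so agreement there suffices.\<close>
  have x_run: "x \<omega> t a = run (noise \<omega>) t a" if w: "\<omega> \<in> space M" and "a \<in> agents n" for \<omega> t a
    using that(2)
  proof (induction t arbitrary: a)
    case 0
    show ?case
    proof (cases a)
      case Leader
      then show ?thesis using leader[OF w] leader[OF w0] by (simp add: x0_def)
    next
      case (Ordinary i)
      then have "i \<in> {1..n}" using 0 by (auto simp: agents_def)
      then obtain g where "g \<in> {1..Nc}" "i \<in> V g" using cover by blast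
      then show ?thesis
        using initial[OF w] div0 Ordinary by (auto simp: divisive_initial_def)
    qed
  next
    case (Suc t)
    show ?case
    proof (cases a)
      case Leader
      then show ?thesis using leader[OF w] leader[OF w0] by (simp add: x0_def)
    next
      case (Ordinary i)
      then have i: "i \<in> {1..n}" using Suc by (auto simp: agents_def)
      have "x \<omega> (Suc t) (Ordinary i) =
          hk_mean n \<epsilon> (x \<omega> t) i + (if i = 1 then \<xi> (Suc t) \<omega> else 0)"
        using dynamics[OF w i] by (simp add: hk_mean_def)
      also have "hk_mean n \<epsilon> (x \<omega> t) i = hk_mean n \<epsilon> (run (noise \<omega>) t) i"
        using Suc.IH i by (rule hk_mean_cong)
      finally show ?thesis using Ordinary by simp
    qed
  qed
  have T: "(\<integral>\<^sup>+\<omega>. leader_time n \<epsilon> A (x \<omega>) \<partial>M) =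
      (\<integral>\<^sup>+\<omega>. leader_time n \<epsilon> A (run (noise \<omega>)) \<partial>M)"
  proof (intro nn_integral_cong)
    fix \<omega> assume "\<omega> \<in> space M"
    then have "leader_dist n A (x \<omega> t) = leader_dist n A (run (noise \<omega>) t)" for t
      using x_run by (intro leader_dist_cong) auto
    then show "leader_time n \<epsilon> A (x \<omega>) = leader_time n \<epsilon> A (run (noise \<omega>))"
      by (simp add: leader_time_def)
  qed
  have mean: "expectation (\<xi> (Suc t)) = (\<delta>2 - \<delta>1) / 2" for t
    using uniform_expectation[OF rv ab unif] by simp
  show ?thesis
    unfolding T
  proof (intro conjI impI)
    assume eq: "\<delta>1 = \<delta>2"
    show "(\<integral>\<^sup>+\<omega>. leader_time n \<epsilon> A (run (noise \<omega>)) \<partial>M) = \<infinity>"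
    proof (rule expected_leader_time_infinite)
      show "expectation (\<xi> (Suc t)) = 0" for t using mean eq by simp
      show "0 < prob (\<xi> (Suc t) -` {..- \<delta>2 / 2} \<inter> space M)" for t
      proof -
        have "prob (\<xi> (Suc t) -` {..- \<delta>2 / 2} \<inter> space M) =
            (- \<delta>2 / 2 - - \<delta>1) / (\<delta>2 - - \<delta>1)"
          by (rule uniform_prob_le[OF rv ab unif]) (use eq delta in auto)
        also have "\<dots> > 0" using eq delta by simp
        finally show ?thesis .
      qed
    qed
  next
    assume lt: "\<delta>1 < \<delta>2"
    have "(\<integral>\<^sup>+\<omega>. leader_time n \<epsilon> A (run (noise \<omega>)) \<partial>M) \<le>
        ennreal (real n / ((\<delta>2 - \<delta>1) / 2) * (A - xs 1 + \<delta>2))"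
      by (rule expected_leader_time_le) (use mean lt in auto)
    also have "\<dots> \<le> ennreal (2 * real n / (\<delta>2 - \<delta>1) * (A - xs 1 + \<epsilon> + real Nc * \<delta>2))"
    proof (rule ennreal_leI)
      \<comment> \<open>The bound obtained has \<open>\<delta>2\<close> where the claim allows
        \<open>\<epsilon> + Nc * \<delta>2\<close>.\<close>
      have "1 * \<delta>2 \<le> real Nc * \<delta>2" using Nc_ge delta by (intro mult_right_mono) auto
      then have "2 * real n / (\<delta>2 - \<delta>1) * (A - xs 1 + \<delta>2) \<le>
          2 * real n / (\<delta>2 - \<delta>1) * (A - xs 1 + \<epsilon> + real Nc * \<delta>2)"
        using lt eps by (intro mult_left_mono) auto
      then show "real n / ((\<delta>2 - \<delta>1) / 2) * (A - xs 1 + \<delta>2) \<le>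
          2 * real n / (\<delta>2 - \<delta>1) * (A - xs 1 + \<epsilon> + real Nc * \<delta>2)"
        by (simp add: mult.commute)
    qed
    finally show "(\<integral>\<^sup>+\<omega>. leader_time n \<epsilon> A (run (noise \<omega>)) \<partial>M) \<le>
      ennreal (2 * real n / (\<delta>2 - \<delta>1) * (A - xs 1 + \<epsilon> + real Nc * \<delta>2))" .
  qed
qed

end
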